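(* Let $n\in\mathbb{N}$, let $\{q_j\}_{j\in\mathbb{N}}$ be an infinite sequence of positive integers and let $\boldsymbol{\tau}=(\tau_1,\dots,\tau_n)\in\mathbb{R}_+^n$ be an $n$-tuple of positive real numbers. Suppose that the limit $$\lim_{j\to\infty}\frac{\log q_j}{\log q_{j-1}}=k>1$$ exists and that $\max_{1\le i\le n}\tau_i<k-1<\infty$. Then $$\dim_H\left\{\mathbf{x}\in[0,1]^n:\ \|q_jx_i\|<q_j^{-\tau_i}\ (1\le i\le n)\ \text{for all sufficiently large } j\in\mathbb{N}\right\}=\min_{1\le j\le n}\left\{\frac{n-\frac{1}{k-1}\sum_{i=1}^n\tau_i+\sum_{i:\tau_j>\tau_i}(\tau_j-\tau_i)}{\tau_j+1}\right\}.$$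
   Context: For a real number $y$, $\|y\|$ denotes the distance from $y$ to the nearest integer. $\dim_H$ denotes Hausdorff dimension (with respect to the Euclidean/max metric on $\mathbb{R}^n$). *)

theory Defs
  imports "HOL-Analysis.Analysis"
begin

definition nearest_int_dist :: "real \<Rightarrow> real" where
  "nearest_int_dist y = infdist y \<int>"

text \<open>
  The gauge \<open>diam(U)^s\<close> with the usual conventions that \<open>{}\<close> contributes \<open>0\<close> and that
  \<open>0^0 = 1\<close> for nonempty \<open>U\<close>; they are spelled out because \<open>0 powr 0 = 0\<close>.
\<close>

definition hausdorff_gauge :: "real \<Rightarrow> 'a::metric_space set \<Rightarrow> ennreal" where
  "hausdorff_gauge s U =
     (if U = {} then 0 else if s = 0 then 1 else ennreal (diameter U powr s))"

text \<open>
  Boundedness is required explicitly because \<^const>\<open>diameter\<close> is a real number and carries no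
  information about unbounded sets. Finite covers are included by padding with \<open>{}\<close>.
\<close>

definition hausdorff_premeasure :: "real \<Rightarrow> real \<Rightarrow> 'a::metric_space set \<Rightarrow> ennreal" where
  "hausdorff_premeasure s \<delta> A =
     (INF U \<in> {U :: nat \<Rightarrow> 'a set. A \<subseteq> (\<Union>i. U i) \<and> (\<forall>i. bounded (U i) \<and> diameter (U i) \<le> \<delta>)}.
        (\<Sum>i. hausdorff_gauge s (U i)))"

text \<open>The supremum over \<open>\<delta> > 0\<close> is the limit as \<open>\<delta>\<close> tends to \<open>0\<close>, by monotonicity.\<close>

definition hausdorff_measure :: "real \<Rightarrow> 'a::metric_space set \<Rightarrow> ennreal" where
  "hausdorff_measure s A = (SUP \<delta> \<in> {0<..}. hausdorff_premeasure s \<delta> A)"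

definition hausdorff_dim :: "'a::metric_space set \<Rightarrow> ereal" where
  "hausdorff_dim A = (INF s \<in> {s. 0 \<le> s \<and> hausdorff_measure s A = 0}. ereal s)"

end

theory Submission
  imports Defs
begin

text \<open>
  Write \<open>L j = ln (q j)\<close>; since \<open>L (j + 1) / L j\<close> tends to \<open>k\<close>, the sum of all \<open>L l\<close> with \<open>l < j\<close> is
  asymptotically \<open>L j / (k - 1)\<close>. At level \<open>j\<close> the set consists of boxes around the points \<open>p / q j\<close>
  with sides \<open>q j powr (- (1 + \<tau> i))\<close>, and a box of level \<open>j\<close> contains about
  \<open>q (j + 1) * q j powr (- (1 + \<tau> i))\<close> of them in direction \<open>i\<close> at the next level, so there are
  about \<open>q j powr (n - (\<Sum>i. \<tau> i) / (k - 1))\<close> boxes of level \<open>j\<close>. Covering them by cubes of side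
  \<open>q j powr (- (1 + \<tau> a))\<close> gives the upper bound for each \<open>a\<close>.

  For the lower bound the mass is spread uniformly over a Cantor subset. A ball of radius
  \<open>r = q j powr (- u)\<close> with \<open>u \<ge> 1\<close> that is larger than \<open>1 / q (j + 1)\<close> has mass at most about
  \<open>q j powr (- (n - (\<Sum>i. \<tau> i) / (k - 1) + (\<Sum>i. max 0 (u - 1 - \<tau> i))))\<close>. This exponent is
  piecewise affine in \<open>u\<close>, so comparing it with \<open>s * u\<close> at the breakpoints \<open>u = 1 + \<tau> i\<close> suffices, and
  these are the terms of the minimum.
\<close>

section \<open>Hausdorff measure\<close>

lemma hausdorff_measure_eq_0_iff:
  "hausdorff_measure s A = 0 \<longleftrightarrow>
     (\<forall>\<delta>>0. \<forall>e>0. \<exists>U :: nat \<Rightarrow> 'a::metric_space set. A \<subseteq> (\<Union>i. U i) \<and>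
        (\<forall>i. bounded (U i) \<and> diameter (U i) \<le> \<delta>) \<and> (\<Sum>i. hausdorff_gauge s (U i)) < e)"
  (is "_ \<longleftrightarrow> ?R")
proof -
  have "hausdorff_measure s A = 0 \<longleftrightarrow> (\<forall>\<delta>>0. hausdorff_premeasure s \<delta> A = 0)"
    unfolding hausdorff_measure_def bot_ennreal[symmetric] SUP_bot_conv by auto
  also have "\<dots> \<longleftrightarrow> ?R"
    unfolding hausdorff_premeasure_def bot_ennreal[symmetric] INF_eq_bot_iff
    by (auto simp: bot_ennreal)
  finally show ?thesis .
qed

lemma ennreal_pos_real:
  assumes "(0::ennreal) < e"
  obtains e' :: real where "0 < e'" "ennreal e' < e"
proof -
  obtain x where x: "0 < x" "x < e" using dense[OF assms] by blast
  then show thesis by (cases x) (auto simp: ennreal_less_zero_iff intro: that)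
qed

text \<open>The approximable set is a countable union over the index from which its inequalities
  hold. Giving the \<open>n\<close>-th cover the budget \<open>e' * (1/2) ^ Suc n\<close> keeps the
  total at most \<open>e'\<close>.\<close>

lemma hausdorff_measure_UN_eq_0:
  fixes A :: "nat \<Rightarrow> 'a::metric_space set"
  assumes "\<And>n. hausdorff_measure s (A n) = 0" "B \<subseteq> (\<Union>n. A n)"
  shows "hausdorff_measure s B = 0"
  unfolding hausdorff_measure_eq_0_iff
proof (intro allI impI)
  fix \<delta> :: real and e :: ennreal
  assume "\<delta> > 0" "e > 0"
  from \<open>e > 0\<close> obtain e' :: real where e': "0 < e'" "ennreal e' < e"
    by (rule ennreal_pos_real)
  have "\<exists>U. A n \<subseteq> (\<Union>i. U i) \<and> (\<forall>i. bounded (U i) \<and> diameter (U i) \<le> \<delta>) \<and>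
         (\<Sum>i. hausdorff_gauge s (U i)) < ennreal (e' * (1/2) ^ Suc n)" for n
    using assms(1)[of n, unfolded hausdorff_measure_eq_0_iff] \<open>\<delta> > 0\<close> e' by auto
  then obtain U where U: "\<And>n. A n \<subseteq> (\<Union>i. U n i)"
      "\<And>n i. bounded (U n i)" "\<And>n i. diameter (U n i) \<le> \<delta>"
      "\<And>n. (\<Sum>i. hausdorff_gauge s (U n i)) < ennreal (e' * (1/2) ^ Suc n)"
    by metis
  \<comment> \<open>\<open>prod_decode\<close> lists the double family of covers as one
    sequence.\<close>
  define V where "V = (\<lambda>k. case_prod U (prod_decode k))"
  have "x \<in> (\<Union>k. V k)" if "x \<in> B" for x
  proof -
    obtain n where "x \<in> A n" using subsetD[OF assms(2) \<open>x \<in> B\<close>] by blast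
    then obtain i where "x \<in> U n i" using U(1) by blast
    then have "x \<in> V (prod_encode (n, i))" by (simp add: V_def)
    then show ?thesis by blast
  qed
  moreover have "bounded (V k) \<and> diameter (V k) \<le> \<delta>" for k
    using U(2,3) by (auto simp: V_def split: prod.split)
  moreover have "(\<Sum>k. hausdorff_gauge s (V k)) < e"
  proof -
    have "(\<Sum>k. hausdorff_gauge s (V k)) = (\<Sum>n. \<Sum>i. hausdorff_gauge s (U n i))"
      using suminf_ennreal_2dimen[of "\<lambda>n. \<Sum>i. hausdorff_gauge s (U n i)"
          "\<lambda>(n, i). hausdorff_gauge s (U n i)"]
      by (simp add: V_def o_def case_prod_unfold)
    also have "\<dots> \<le> (\<Sum>n. ennreal (e' * (1/2) ^ Suc n))"
      by (intro suminf_le less_imp_le[OF U(4)]) auto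
    also have "\<dots> = ennreal e'"
      using sums_mult[OF power_half_series, of e'] e' by (intro suminf_ennreal_eq) auto
    finally show ?thesis by (rule le_less_trans[OF _ e'(2)])
  qed
  ultimately show "\<exists>U. B \<subseteq> (\<Union>i. U i) \<and> (\<forall>i. bounded (U i) \<and> diameter (U i) \<le> \<delta>) \<and>
      (\<Sum>i. hausdorff_gauge s (U i)) < e"
    by (intro exI[of _ V]) auto
qed

text \<open>Counting boxes produces finite families with a common diameter bound \<open>d\<close>;
  for \<open>s > 0\<close> the gauge is monotone in the diameter, so such a cover costs at most
  \<open>card F * d powr s\<close>.\<close>

lemma hausdorff_measure_eq_0_finite_covers:
  fixes A :: "'a::metric_space set"
  assumes "s > 0"
    and cover: "\<And>\<delta> e. \<delta> > 0 \<Longrightarrow> e > 0 \<Longrightarrow> \<exists>F d. finite F \<and> A \<subseteq> \<Union>F \<and> d \<le> \<delta> \<and>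
       (\<forall>B\<in>F. bounded B \<and> diameter B \<le> d) \<and> real (card F) * d powr s < e"
  shows "hausdorff_measure s A = 0"
  unfolding hausdorff_measure_eq_0_iff
proof (intro allI impI)
  fix \<delta> :: real and e :: ennreal
  assume "\<delta> > 0" "e > 0"
  from \<open>e > 0\<close> obtain e' :: real where e': "0 < e'" "ennreal e' < e"
    by (rule ennreal_pos_real)
  obtain F d where F: "finite F" "A \<subseteq> \<Union>F" "d \<le> \<delta>"
      "\<And>B. B \<in> F \<Longrightarrow> bounded B \<and> diameter B \<le> d" "real (card F) * d powr s < e'"
    using cover[OF \<open>\<delta> > 0\<close> e'(1)] by metis
  obtain h where h: "bij_betw h {0..<card F} F"
    using ex_bij_betw_nat_finite[OF F(1)] by blast
  \<comment> \<open>Padding by \<open>{}\<close>, whose gauge is 0, leaves the cost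
    unchanged.\<close>
  define V where "V = (\<lambda>i. if i < card F then h i else {})"
  have hF: "h i \<in> F" if "i < card F" for i using h that by (auto simp: bij_betw_def)
  have "A \<subseteq> (\<Union>i. V i)"
  proof
    fix x assume "x \<in> A"
    then obtain B where "B \<in> F" "x \<in> B" using F(2) by blast
    moreover obtain i where "i < card F" "h i = B"
      using h \<open>B \<in> F\<close> by (metis atLeastLessThan_iff bij_betw_def imageE)
    ultimately show "x \<in> (\<Union>i. V i)" by (auto simp: V_def)
  qed
  moreover have "bounded (V i) \<and> diameter (V i) \<le> \<delta>" for i
    using F(3,4) hF \<open>\<delta> > 0\<close> by (force simp: V_def)
  moreover have "(\<Sum>i. hausdorff_gauge s (V i)) < e"
  proof -
    have "(\<Sum>i. hausdorff_gauge s (V i)) = (\<Sum>i<card F. hausdorff_gauge s (V i))"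
      by (intro suminf_finite) (auto simp: V_def hausdorff_gauge_def)
    also have "\<dots> \<le> (\<Sum>i<card F. ennreal (d powr s))"
    proof (intro sum_mono)
      fix i assume "i \<in> {..<card F}"
      then have "h i \<in> F" by (simp add: hF)
      then show "hausdorff_gauge s (V i) \<le> ennreal (d powr s)"
        using F(4)[of "h i"] \<open>s > 0\<close> diameter_ge_0[of "h i"]
        by (auto simp: V_def hausdorff_gauge_def intro!: ennreal_leI powr_mono2)
    qed
    also have "\<dots> = ennreal (real (card F) * d powr s)"
      by (simp add: ennreal_mult ennreal_of_nat_eq_real_of_nat)
    also have "\<dots> \<le> ennreal e'" using F(5) by (intro ennreal_leI) auto
    also have "\<dots> < e" by (rule e')
    finally show ?thesis .
  qed
  ultimately show "\<exists>U. A \<subseteq> (\<Union>i. U i) \<and> (\<forall>i. bounded (U i) \<and> diameter (U i) \<le> \<delta>) \<and>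
      (\<Sum>i. hausdorff_gauge s (U i)) < e"
    by blast
qed

text \<open>At exponent 0 every nonempty set costs 1. This settles \<open>s = 0\<close> in the
  infimum defining \<open>hausdorff_dim\<close>, which the mass argument for \<open>s > 0\<close>
  leaves open.\<close>

lemma hausdorff_measure_0_nonzero:
  assumes "A \<noteq> {}"
  shows "hausdorff_measure 0 A \<noteq> 0"
proof
  assume "hausdorff_measure 0 A = 0"
  then obtain U :: "nat \<Rightarrow> 'a set" where U: "A \<subseteq> (\<Union>i. U i)" "(\<Sum>i. hausdorff_gauge 0 (U i)) < 1"
    unfolding hausdorff_measure_eq_0_iff by (meson zero_less_one)
  then obtain i where "U i \<noteq> {}" using assms by blast
  then have "1 \<le> sum (\<lambda>i. hausdorff_gauge 0 (U i)) {i}" by (simp add: hausdorff_gauge_def)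
  also have "\<dots> \<le> (\<Sum>i. hausdorff_gauge 0 (U i))" by (intro sum_le_suminf) auto
  finally show False using U(2) by simp
qed

text \<open>
  A discrete mass distribution principle: the measure is replaced by the normalised counting
  measures of finite sets \<open>P m\<close>, so that no limit measure has to be constructed.
\<close>

lemma hausdorff_measure_nonzero:
  fixes K :: "nat \<Rightarrow> 'a::metric_space set" and P :: "nat \<Rightarrow> 'a set"
  assumes "s > 0" "\<delta> > 0" "C > 0"
    and compact: "\<And>m. compact (K m)" and decr: "\<And>m. K (Suc m) \<subseteq> K m"
    and sub: "(\<Inter>m. K m) \<subseteq> A"
    and P: "\<And>m. finite (P m)" "\<And>m. P m \<noteq> {}" "\<And>m. P m \<subseteq> K m"
    and mass: "\<And>x r. 0 < r \<Longrightarrow> r \<le> \<delta> \<Longrightarrow>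
      \<forall>\<^sub>F m in sequentially. real (card (P m \<inter> ball x r)) \<le> C * r powr s * real (card (P m))"
  shows "hausdorff_measure s A \<noteq> 0"
proof
  assume "hausdorff_measure s A = 0"
  \<comment> \<open>Covering the points by balls of radii \<open>\<rho> i\<close> will force the sum
    of \<open>\<rho> i powr s\<close> to be at least \<open>1 / C = 2 * e\<close>, whereas the given
    cover costs less than \<open>e / 2\<close> and its enlargement to balls adds at most
    \<open>e / 2\<close>.\<close>
  define e where "e = 1 / (2 * C)"
  have "e > 0" using \<open>C > 0\<close> by (simp add: e_def)
  obtain U :: "nat \<Rightarrow> 'a set" where U: "A \<subseteq> (\<Union>i. U i)" "\<And>i. bounded (U i)"
      "\<And>i. diameter (U i) \<le> \<delta> / 2" "(\<Sum>i. hausdorff_gauge s (U i)) < ennreal (e / 2)"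
    using \<open>hausdorff_measure s A = 0\<close>[unfolded hausdorff_measure_eq_0_iff] \<open>\<delta> > 0\<close> \<open>e > 0\<close>
    by (metis half_gt_zero ennreal_less_zero_iff)
  \<comment> \<open>Compactness needs open sets, so each diameter is enlarged slightly, also when it
    is 0. Right continuity of the power bounds the extra costs by a geometric series with sum
    \<open>e / 2\<close>.\<close>
  have "\<exists>\<rho>>diameter (U i). \<rho> \<le> \<delta> \<and> \<rho> powr s < diameter (U i) powr s + e / 2 * (1/2) ^ Suc i" for i
  proof -
    have "((\<lambda>\<rho>. \<rho> powr s) \<longlongrightarrow> diameter (U i) powr s) (at_right (diameter (U i)))"
      using \<open>s > 0\<close> diameter_ge_0[OF U(2), of i]
      by (intro tendsto_powr2 tendsto_ident_at tendsto_const
          eventually_mono[OF eventually_at_right_less[of "diameter (U i)"]]) auto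
    then have "\<forall>\<^sub>F \<rho> in at_right (diameter (U i)).
        \<rho> powr s < diameter (U i) powr s + e / 2 * (1/2) ^ Suc i"
      using \<open>e > 0\<close> by (intro order_tendstoD) auto
    moreover have "\<forall>\<^sub>F \<rho> in at_right (diameter (U i)). \<rho> < \<delta>"
      using U(3)[of i] \<open>\<delta> > 0\<close> by (intro order_tendstoD[OF tendsto_ident_at]) auto
    moreover have "\<forall>\<^sub>F \<rho> in at_right (diameter (U i)). diameter (U i) < \<rho>"
      by (simp add: eventually_at_filter)
    ultimately have "\<forall>\<^sub>F \<rho> in at_right (diameter (U i)). diameter (U i) < \<rho> \<and> \<rho> \<le> \<delta> \<and>
        \<rho> powr s < diameter (U i) powr s + e / 2 * (1/2) ^ Suc i"
      by eventually_elim auto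
    then show ?thesis using eventually_happens' trivial_limit_at_right_real by blast
  qed
  then obtain \<rho> where \<rho>: "\<And>i. diameter (U i) < \<rho> i" "\<And>i. \<rho> i \<le> \<delta>"
      "\<And>i. \<rho> i powr s < diameter (U i) powr s + e / 2 * (1/2) ^ Suc i"
    by metis
  have \<rho>_pos: "\<rho> i > 0" for i using \<rho>(1)[of i] diameter_ge_0[OF U(2), of i] by linarith
  define c where "c = (\<lambda>i. SOME x. x \<in> U i)"
  \<comment> \<open>For empty \<open>U i\<close> the choice \<open>c i\<close> is arbitrary and the
    gauge is 0, so no ball may replace it.\<close>
  define V where "V = (\<lambda>i. if U i = {} then {} else ball (c i) (\<rho> i))"
  have UV: "U i \<subseteq> V i" for i
  proof
    fix x assume "x \<in> U i"
    then have "c i \<in> U i" unfolding c_def by (rule someI)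
    then have "dist (c i) x \<le> diameter (U i)" using U(2) \<open>x \<in> U i\<close> by (intro diameter_bounded_bound)
    then show "x \<in> V i" using \<rho>(1)[of i] \<open>x \<in> U i\<close> by (auto simp: V_def)
  qed
  \<comment> \<open>The sets \<open>V i\<close> and the complements of the stages form an open cover
    of the compact set \<open>K 0\<close>. A finite subcover shows that finitely many
    \<open>V i\<close> cover every late stage, hence the points \<open>P m\<close>.\<close>
  have "K 0 \<subseteq> \<Union>(range V \<union> range (\<lambda>m. - K m))"
  proof
    fix x assume "x \<in> K 0"
    show "x \<in> \<Union>(range V \<union> range (\<lambda>m. - K m))"
    proof (cases "x \<in> (\<Inter>m. K m)")
      case True
      then obtain i where "x \<in> U i" using sub U(1) by blast
      then have "x \<in> V i" using UV by blast
      then show ?thesis by blast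
    qed auto
  qed
  moreover have "open B" if "B \<in> range V \<union> range (\<lambda>m. - K m)" for B
    using that compact by (auto simp: V_def open_Compl compact_imp_closed)
  ultimately obtain D where D: "D \<subseteq> range V \<union> range (\<lambda>m. - K m)" "finite D" "K 0 \<subseteq> \<Union>D"
    using compactE[OF compact[of 0]] by metis
  obtain I where I: "finite I" "D \<inter> range V = V ` I"
    by (metis D(2) finite_Int finite_subset_image inf.cobounded2)
  obtain M where M: "finite M" "D \<inter> range (\<lambda>m. - K m) = (\<lambda>m. - K m) ` M"
    by (metis D(2) finite_Int finite_subset_image inf.cobounded2)
  have K_anti: "K m \<subseteq> K m'" if "m' \<le> m" for m m'
    using lift_Suc_antimono_le[of K, OF decr that] .
  obtain b where b: "\<And>m. m \<in> M \<Longrightarrow> m \<le> b" using M(1) by (meson finite_nat_set_iff_bounded_le)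
  have KV: "K m \<subseteq> (\<Union>i\<in>I. V i)" if "m \<ge> b" for m
  proof
    fix x assume x: "x \<in> K m"
    then have "x \<in> K 0" using K_anti[of 0 m] by auto
    then obtain B where B: "B \<in> D" "x \<in> B" using D(3) by blast
    have "B \<notin> (\<lambda>m. - K m) ` M"
    proof
      assume "B \<in> (\<lambda>m. - K m) ` M"
      then obtain m' where m': "m' \<in> M" "B = - K m'" by blast
      have "K m \<subseteq> K m'" using b[OF m'(1)] that by (intro K_anti) simp
      then show False using B x m' by blast
    qed
    then have "B \<notin> range (\<lambda>m. - K m)" using B(1) M(2) by blast
    then have "B \<in> D \<inter> range V" using B(1) D(1) by blast
    then have "B \<in> V ` I" using I(2) by simp
    then show "x \<in> (\<Union>i\<in>I. V i)" using B(2) by blast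
  qed
  \<comment> \<open>The mass bound holds only for large \<open>m\<close> depending on the ball; for
    finitely many balls a common \<open>m \<ge> b\<close> exists.\<close>
  have "\<forall>\<^sub>F m in sequentially. real (card (P m \<inter> ball (c i) (\<rho> i))) \<le> C * \<rho> i powr s * real (card (P m))"
    for i using \<rho>_pos \<rho>(2) by (intro mass) auto
  then have "\<forall>\<^sub>F m in sequentially. m \<ge> b \<and> (\<forall>i\<in>I. real (card (P m \<inter> ball (c i) (\<rho> i)))
      \<le> C * \<rho> i powr s * real (card (P m)))"
    using I(1) by (intro eventually_conj eventually_ge_at_top) (simp add: eventually_ball_finite)
  then obtain m where m: "m \<ge> b"
      "\<And>i. i \<in> I \<Longrightarrow> real (card (P m \<inter> ball (c i) (\<rho> i))) \<le> C * \<rho> i powr s * real (card (P m))"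
    using eventually_happens'[OF sequentially_bot] by blast
  define I' where "I' = {i \<in> I. U i \<noteq> {}}"
  have "finite I'" using I(1) by (simp add: I'_def)
  have "P m \<subseteq> (\<Union>i\<in>I'. P m \<inter> ball (c i) (\<rho> i))"
    using P(3)[of m] KV[OF m(1)] by (fastforce simp: V_def I'_def split: if_splits)
  then have "card (P m) \<le> card (\<Union>i\<in>I'. P m \<inter> ball (c i) (\<rho> i))"
    using P(1) \<open>finite I'\<close> by (intro card_mono) auto
  also have "\<dots> \<le> (\<Sum>i\<in>I'. card (P m \<inter> ball (c i) (\<rho> i)))"
    by (rule card_UN_le[OF \<open>finite I'\<close>])
  finally have "real (card (P m)) \<le> (\<Sum>i\<in>I'. real (card (P m \<inter> ball (c i) (\<rho> i))))"
    by (metis of_nat_le_iff of_nat_sum)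
  also have "\<dots> \<le> (\<Sum>i\<in>I'. C * \<rho> i powr s * real (card (P m)))"
    by (intro sum_mono m) (simp add: I'_def)
  also have "\<dots> = real (card (P m)) * (C * (\<Sum>i\<in>I'. \<rho> i powr s))"
    by (simp add: sum_distrib_left sum_distrib_right mult_ac)
  finally have "1 \<le> C * (\<Sum>i\<in>I'. \<rho> i powr s)"
    using P(1,2)[of m] by (simp add: card_gt_0_iff)
  then have ge: "2 * e \<le> (\<Sum>i\<in>I'. \<rho> i powr s)"
    using \<open>C > 0\<close> by (simp add: e_def field_simps)
  have "ennreal (\<Sum>i\<in>I'. diameter (U i) powr s) = (\<Sum>i\<in>I'. hausdorff_gauge s (U i))"
    using \<open>s > 0\<close> by (auto simp: I'_def hausdorff_gauge_def simp flip: sum_ennreal intro!: sum.cong)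
  also have "\<dots> \<le> (\<Sum>i. hausdorff_gauge s (U i))"
    by (intro sum_le_suminf \<open>finite I'\<close>) auto
  also have "\<dots> < ennreal (e / 2)" by (rule U)
  finally have "(\<Sum>i\<in>I'. diameter (U i) powr s) < e / 2"
    by (simp add: ennreal_less_iff sum_nonneg)
  moreover have "(\<Sum>i\<in>I'. e / 2 * (1/2) ^ Suc i) \<le> e / 2"
  proof -
    have "(\<Sum>i\<in>I'. (1/2) ^ Suc i) \<le> (1::real)"
      using sum_le_suminf[OF sums_summable[OF power_half_series] \<open>finite I'\<close>]
        sums_unique[OF power_half_series] by auto
    then have "e / 2 * (\<Sum>i\<in>I'. (1/2) ^ Suc i) \<le> e / 2 * 1"
      using \<open>e > 0\<close> by (intro mult_left_mono) auto
    then show ?thesis by (simp only: sum_distrib_left mult_1_right)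
  qed
  moreover have "(\<Sum>i\<in>I'. \<rho> i powr s) \<le> (\<Sum>i\<in>I'. diameter (U i) powr s + e / 2 * (1/2) ^ Suc i)"
    by (intro sum_mono less_imp_le[OF \<rho>(3)])
  ultimately show False using ge \<open>e > 0\<close> by (simp add: sum.distrib del: power_Suc)
qed

section \<open>Growth of the logarithms of the denominators\<close>

text \<open>After multiplication by \<open>\<kappa> - 1\<close> each term is at most
  \<open>L (Suc l) - L l\<close>, and the sum telescopes.\<close>

lemma sum_le_of_growth:
  fixes L :: "nat \<Rightarrow> real"
  assumes "1 < \<kappa>" "\<And>l. 0 \<le> L l" "\<And>l. \<kappa> * L l \<le> L (Suc l)"
  shows "(\<Sum>l<j. L l) \<le> L j / (\<kappa> - 1)"
proof -
  have "(\<kappa> - 1) * (\<Sum>l<j. L l) = (\<Sum>l<j. \<kappa> * L l - L l)"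
    by (simp add: sum_distrib_left algebra_simps)
  also have "\<dots> \<le> (\<Sum>l<j. L (Suc l) - L l)" by (intro sum_mono) (use assms(3) in simp)
  also have "\<dots> = L j - L 0" by (rule sum_lessThan_telescope)
  also have "\<dots> \<le> L j" using assms(2)[of 0] by simp
  finally show ?thesis using \<open>1 < \<kappa>\<close> by (simp add: pos_le_divide_eq mult.commute)
qed

text \<open>The same telescoping with the inequality reversed. The term \<open>L 0\<close> that
  survives here later contributes only a constant factor.\<close>

lemma sum_ge_of_growth:
  fixes L :: "nat \<Rightarrow> real"
  assumes "1 < \<kappa>" "\<And>l. L (Suc l) \<le> \<kappa> * L l"
  shows "(L j - L 0) / (\<kappa> - 1) \<le> (\<Sum>l<j. L l)"
proof -
  have "L j - L 0 = (\<Sum>l<j. L (Suc l) - L l)" by (rule sum_lessThan_telescope[symmetric])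
  also have "\<dots> \<le> (\<Sum>l<j. \<kappa> * L l - L l)" by (intro sum_mono) (use assms(2) in simp)
  also have "\<dots> = (\<kappa> - 1) * (\<Sum>l<j. L l)" by (simp add: sum_distrib_left algebra_simps)
  finally show ?thesis using \<open>1 < \<kappa>\<close> by (simp add: pos_divide_le_eq mult.commute)
qed

lemma filterlim_sequentially_shift:
  "filterlim (\<lambda>n. f (n + k)) F sequentially \<longleftrightarrow> filterlim f F sequentially"
  by (simp add: filterlim_iff eventually_sequentially_seg[where P = "\<lambda>n. P (f n)" for P])

lemma growth_limit:
  fixes L :: "nat \<Rightarrow> real"
  assumes nonneg: "\<And>j. 0 \<le> L j" and lim: "(\<lambda>j. L (Suc j) / L j) \<longlonglongrightarrow> k" and "1 < k"
  shows "\<kappa> < k \<Longrightarrow> \<forall>\<^sub>F j in sequentially. \<kappa> * L j \<le> L (Suc j)"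
    and "k < \<kappa> \<Longrightarrow> \<forall>\<^sub>F j in sequentially. L (Suc j) \<le> \<kappa> * L j"
    and "filterlim L at_top sequentially"
proof -
  have "\<forall>\<^sub>F j in sequentially. 1 < L (Suc j) / L j" using lim \<open>1 < k\<close> by (rule order_tendstoD)
  then have pos: "\<forall>\<^sub>F j in sequentially. 0 < L j"
  proof eventually_elim
    case (elim j)
    \<comment> \<open>Division by 0 yields 0, so a ratio above 1 excludes
      \<open>L j = 0\<close>.\<close>
    then have "L j \<noteq> 0" by auto
    then show ?case using nonneg[of j] by simp
  qed
  show lower: "\<forall>\<^sub>F j in sequentially. \<kappa> * L j \<le> L (Suc j)" if "\<kappa> < k" for \<kappa>
    using order_tendstoD(1)[OF lim that] pos by eventually_elim (simp add: pos_less_divide_eq)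
  show "\<forall>\<^sub>F j in sequentially. L (Suc j) \<le> \<kappa> * L j" if "k < \<kappa>" for \<kappa>
    using order_tendstoD(2)[OF lim that] pos by eventually_elim (simp add: pos_divide_less_eq)
  obtain \<kappa> where \<kappa>: "1 < \<kappa>" "\<kappa> < k" using dense[OF \<open>1 < k\<close>] by blast
  obtain J where J: "\<And>j. j \<ge> J \<Longrightarrow> 0 < L j \<and> \<kappa> * L j \<le> L (Suc j)"
    using eventually_conj[OF pos lower[OF \<kappa>(2)]] unfolding eventually_sequentially by blast
  \<comment> \<open>Growth is at least geometric from \<open>J\<close> on; Bernoulli's inequality
    turns this into a linear lower bound, which suffices for divergence.\<close>
  have "\<kappa> ^ m * L J \<le> L (m + J)" for m
  proof (induction m)
    case (Suc m)
    have "\<kappa> ^ Suc m * L J \<le> \<kappa> * L (m + J)" using Suc \<kappa> by simp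
    also have "\<dots> \<le> L (Suc m + J)" using J[of "m + J"] by simp
    finally show ?case .
  qed simp
  moreover have "real m * ((\<kappa> - 1) * L J) \<le> \<kappa> ^ m * L J" for m
  proof -
    have "real m * (\<kappa> - 1) \<le> \<kappa> ^ m" using Bernoulli_inequality[of "\<kappa> - 1" m] \<kappa>(1) by simp
    then show ?thesis unfolding mult.assoc[symmetric] by (intro mult_right_mono nonneg)
  qed
  ultimately have le: "real m * ((\<kappa> - 1) * L J) \<le> L (m + J)" for m by (rule order_trans[rotated])
  have "filterlim (\<lambda>m. real m * ((\<kappa> - 1) * L J)) at_top sequentially"
    using J[of J] \<kappa>(1)
    by (intro filterlim_at_top_mult_tendsto_pos[OF tendsto_const _ filterlim_real_sequentially]) auto
  then have "filterlim (\<lambda>m. L (m + J)) at_top sequentially"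
    by (rule filterlim_at_top_mono) (simp add: le)
  then show "filterlim L at_top sequentially" unfolding filterlim_sequentially_shift .
qed

section \<open>A Cantor set of simultaneously approximable numbers\<close>

lemma finite_int_interval: "finite {p::int. a \<le> real_of_int p \<and> real_of_int p \<le> b}"
proof -
  have "{p::int. a \<le> real_of_int p \<and> real_of_int p \<le> b} = {\<lceil>a\<rceil>..\<lfloor>b\<rfloor>}"
    by (auto simp: ceiling_le_iff le_floor_iff)
  then show ?thesis by simp
qed

text \<open>The hypothesis makes the right-hand side nonnegative, so that the bound also covers
  intervals without integers.\<close>

lemma card_int_interval:
  assumes "a \<le> b + 1"
  shows "real (card {p::int. a \<le> real_of_int p \<and> real_of_int p \<le> b}) \<le> b - a + 1"
proof -
  have "{p::int. a \<le> real_of_int p \<and> real_of_int p \<le> b} = {\<lceil>a\<rceil>..\<lfloor>b\<rfloor>}"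
    by (auto simp: ceiling_le_iff le_floor_iff)
  moreover have "real (nat (\<lfloor>b\<rfloor> + 1 - \<lceil>a\<rceil>)) \<le> b - a + 1"
    using assms of_int_floor_le[of b] le_of_int_ceiling[of a]
    by (cases "\<lfloor>b\<rfloor> + 1 \<le> \<lceil>a\<rceil>") (simp, simp, linarith)
  ultimately show ?thesis by simp
qed

text \<open>
  With \<open>Q j = exp (L j)\<close>, a node \<open>p\<close> of level \<open>j\<close> stands for the point \<open>p / Q j\<close> with its interval of
  radius \<open>Q j powr (- (1 + \<tau>)) / 2\<close>. Children are placed to the right of \<open>p / Q j\<close> only; every node
  has the same number of them, so that all descendants carry equal mass.
\<close>

locale cantor_tree =
  fixes L :: "nat \<Rightarrow> real" and \<tau> :: real
  assumes tau_pos: "0 < \<tau>"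
    and L_ge: "ln 2 \<le> L j"
    and growth: "(1 + \<tau>) * L j + ln 4 \<le> L (Suc j)"
begin

text \<open>Half of the permitted radius: every point of the closed ball then satisfies the strict
  inequality of the theorem.\<close>

definition radius :: "nat \<Rightarrow> real" where
  "radius j = exp (- (1 + \<tau>) * L j) / 2"

definition pt :: "nat \<Rightarrow> int \<Rightarrow> real" where
  "pt j p = real_of_int p * exp (- L j)"

text \<open>About the number of multiples of \<open>exp (- L (Suc j))\<close> in an interval of
  length \<open>radius j / 2\<close>; the other half of the radius leaves room for the balls of the
  children.\<close>

definition nchild :: "nat \<Rightarrow> nat" where
  "nchild j = nat \<lfloor>exp (L (Suc j) - (1 + \<tau>) * L j) / 4\<rfloor>"

definition children :: "nat \<Rightarrow> int \<Rightarrow> int set" where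
  "children j p =
     {\<lceil>exp (L (Suc j) - L j) * p\<rceil>..<\<lceil>exp (L (Suc j) - L j) * p\<rceil> + int (nchild j)}"

text \<open>Starting from any set of nodes at any level lets one count serve both the whole tree and
  its subtrees.\<close>

primrec descend :: "nat \<Rightarrow> nat \<Rightarrow> int set \<Rightarrow> int set" where
  "descend j 0 S = S"
| "descend j (Suc d) S = (\<Union>p\<in>descend j d S. children (j + d) p)"

text \<open>The root is 1 rather than 0: since \<open>exp (- L 0) \<le> 1/2\<close>, the ball around
  \<open>exp (- L 0)\<close> stays inside the unit interval.\<close>

definition level :: "nat \<Rightarrow> int set" where
  "level m = descend 0 m {1}"

definition stage :: "nat \<Rightarrow> real set" where
  "stage m = (\<Union>p\<in>level m. cball (pt m p) (radius m))"

lemma L_pos: "0 < L j"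
  using L_ge[of j] ln_gt_zero[of "2::real"] by linarith

lemma radius_pos: "0 < radius j"
  by (simp add: radius_def)

lemma growth': "L j + ln 4 \<le> L (Suc j)"
  using growth[of j] mult_pos_pos[OF tau_pos L_pos[of j]] by (simp add: algebra_simps)

lemma ln4: "ln (4::real) = 2 * ln 2"
  using ln_powr[of "2::real" 2] by simp

lemma radius_Suc: "radius (Suc j) \<le> radius j / 2"
proof -
  have *: "ln 2 \<le> L (Suc j) - L j" using growth'[of j] ln4 ln_gt_zero[of "2::real"] by linarith
  also have "\<dots> \<le> (1 + \<tau>) * (L (Suc j) - L j)"
  proof -
    have "0 \<le> L (Suc j) - L j" using * ln_gt_zero[of "2::real"] by linarith
    then have "0 \<le> \<tau> * (L (Suc j) - L j)" using tau_pos by simp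
    then show ?thesis by (simp add: algebra_simps)
  qed
  finally have "- (1 + \<tau>) * L (Suc j) \<le> - (1 + \<tau>) * L j - ln 2" by (simp add: algebra_simps)
  then have "exp (- (1 + \<tau>) * L (Suc j)) \<le> exp (- (1 + \<tau>) * L j - ln 2)"
    by (simp only: exp_le_cancel_iff)
  also have "\<dots> = exp (- (1 + \<tau>) * L j) / 2" by (simp only: exp_diff) simp
  finally show ?thesis by (simp add: radius_def)
qed

lemma radius_le: "radius j \<le> exp (- L j) / 2"
  using mult_pos_pos[OF tau_pos L_pos[of j]] by (simp add: radius_def algebra_simps)

text \<open>The growth condition makes the number under the floor at least 1, so rounding down loses
  at most a factor 2.\<close>

lemma nchild_bounds:
  "exp (L (Suc j) - (1 + \<tau>) * L j) / 8 \<le> real (nchild j)"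
  "real (nchild j) \<le> exp (L (Suc j) - (1 + \<tau>) * L j) / 4"
proof -
  define y where "y = exp (L (Suc j) - (1 + \<tau>) * L j) / 4"
  have "exp (ln 4) \<le> exp (L (Suc j) - (1 + \<tau>) * L j)"
    unfolding exp_le_cancel_iff using growth[of j] by linarith
  then have y: "y \<ge> 1" by (simp add: y_def)
  then have f: "\<lfloor>y\<rfloor> \<ge> 1" by simp
  then have n: "real (nat \<lfloor>y\<rfloor>) = real_of_int \<lfloor>y\<rfloor>" by simp
  have "y / 2 \<le> real_of_int \<lfloor>y\<rfloor>"
    using f floor_correct[of y] by linarith
  then show "exp (L (Suc j) - (1 + \<tau>) * L j) / 8 \<le> real (nchild j)"
    unfolding nchild_def y_def[symmetric] n by (simp add: y_def)
  show "real (nchild j) \<le> exp (L (Suc j) - (1 + \<tau>) * L j) / 4"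
    unfolding nchild_def y_def[symmetric] n by simp
qed

lemma nchild_pos: "0 < nchild j"
  using nchild_bounds(1)[of j] exp_gt_zero[of "L (Suc j) - (1 + \<tau>) * L j"] by (cases "nchild j = 0") auto

text \<open>The position of a child uses at most half of the parent radius, and the radius of the
  child at most the other half.\<close>

lemma child_pt:
  assumes "p' \<in> children j p"
  shows "pt j p \<le> pt (Suc j) p'" "pt (Suc j) p' + radius (Suc j) \<le> pt j p + radius j"
proof -
  define e where "e = exp (L (Suc j) - L j) * p"
  have p': "\<lceil>e\<rceil> \<le> p'" "p' < \<lceil>e\<rceil> + int (nchild j)"
    using assms by (auto simp: children_def e_def)
  have e: "e * exp (- L (Suc j)) = pt j p"
    by (simp add: e_def pt_def exp_diff exp_minus field_simps)
  have "e \<le> p'" using p'(1) by (simp add: ceiling_le_iff)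
  then have "e * exp (- L (Suc j)) \<le> p' * exp (- L (Suc j))" by (intro mult_right_mono) auto
  then show "pt j p \<le> pt (Suc j) p'" by (simp add: e) (simp add: pt_def)
  \<comment> \<open>The strict upper end of the range of children compensates for rounding
    \<open>e\<close> up.\<close>
  have "p' \<le> e + nchild j" using p'(2) ceiling_correct[of e] by linarith
  also have "\<dots> \<le> e + exp (L (Suc j) - (1 + \<tau>) * L j) / 4" using nchild_bounds(2)[of j] by simp
  finally have "p' * exp (- L (Suc j)) \<le>
      (e + exp (L (Suc j) - (1 + \<tau>) * L j) / 4) * exp (- L (Suc j))"
    by (intro mult_right_mono) auto
  also have "\<dots> = pt j p + exp ((L (Suc j) - (1 + \<tau>) * L j) + (- L (Suc j))) / 4"
    by (simp only: distrib_right e exp_add times_divide_eq_left)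
  also have "\<dots> = pt j p + radius j / 2" by (simp add: radius_def algebra_simps)
  finally have "pt (Suc j) p' \<le> pt j p + radius j / 2" by (simp add: pt_def)
  then show "pt (Suc j) p' + radius (Suc j) \<le> pt j p + radius j" using radius_Suc[of j] by linarith
qed

text \<open>Distinct points of level \<open>j\<close> are at least \<open>exp (- L j)\<close> apart,
  while children stay within \<open>radius j\<close>, at most half of that, to the right of their
  parent.\<close>

lemma children_disjoint_less:
  assumes "p < p'"
  shows "children j p \<inter> children j p' = {}"
proof -
  have False if "c \<in> children j p" "c \<in> children j p'" for c
  proof -
    have "pt (Suc j) c < pt j p + radius j"
      using child_pt(2)[OF that(1)] radius_pos[of "Suc j"] by linarith
    also have "\<dots> < pt j p + exp (- L j)" using radius_le[of j] exp_gt_zero[of "- L j"] by linarith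
    also have "\<dots> = (real_of_int p + 1) * exp (- L j)" by (simp add: pt_def algebra_simps)
    also have "\<dots> \<le> pt j p'" unfolding pt_def using assms by (intro mult_right_mono) auto
    also have "\<dots> \<le> pt (Suc j) c" by (rule child_pt(1)[OF that(2)])
    finally show False by simp
  qed
  then show ?thesis by blast
qed

lemma children_disjoint: "p \<noteq> p' \<Longrightarrow> children j p \<inter> children j p' = {}"
  using children_disjoint_less[of p p' j] children_disjoint_less[of p' p j] by (cases "p < p'") auto

section \<open>Descendants, levels and nested stages\<close>

lemma finite_descend: "finite S \<Longrightarrow> finite (descend j d S)"
  by (induction d) (auto simp: children_def)

lemma card_descend:
  assumes "finite S"
  shows "card (descend j d S) = card S * (\<Prod>l<d. nchild (j + l))"
proof (induction d)
  case (Suc d)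
  have "card (descend j (Suc d) S) = (\<Sum>p\<in>descend j d S. card (children (j + d) p))"
    unfolding descend.simps using children_disjoint
    by (intro card_UN_disjoint finite_descend assms) (auto simp: children_def)
  then show ?case using Suc by (simp add: children_def)
qed auto

lemma descend_add: "descend j (d + e) S = descend (j + d) e (descend j d S)"
  by (induction e) (auto simp: add.assoc)

lemma descend_mono: "S \<subseteq> T \<Longrightarrow> descend j d S \<subseteq> descend j d T"
  by (induction d) auto

lemma descend_singleton:
  "p' \<in> descend j d S \<Longrightarrow> \<exists>p\<in>S. p' \<in> descend j d {p}"
  by (induction d arbitrary: p') (auto, blast)

lemma descend_pt:
  assumes "p' \<in> descend j d {p}"
  shows "pt j p \<le> pt (j + d) p' \<and> pt (j + d) p' + radius (j + d) \<le> pt j p + radius j"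
  using assms
proof (induction d arbitrary: p')
  case (Suc d)
  then obtain c where c: "c \<in> descend j d {p}" "p' \<in> children (j + d) c" by auto
  show ?case using Suc.IH[OF c(1)] child_pt[OF c(2)] by auto
qed auto

lemma finite_level: "finite (level m)"
  by (simp add: level_def finite_descend)

lemma card_level: "card (level m) = (\<Prod>l<m. nchild l)"
  by (simp add: level_def card_descend)

lemma card_level_pos: "0 < card (level m)"
  using nchild_pos by (simp add: card_level prod_pos)

lemma level_descend: "j \<le> m \<Longrightarrow> level m = descend j (m - j) (level j)"
  using descend_add[of 0 j "m - j" "{1}"] by (simp add: level_def)

lemma compact_stage: "compact (stage m)"
  unfolding stage_def by (intro compact_UN finite_level compact_cball)

lemma stage_Suc: "stage (Suc m) \<subseteq> stage m"
proof
  fix x assume "x \<in> stage (Suc m)"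
  then obtain p' where p': "p' \<in> level (Suc m)" "dist (pt (Suc m) p') x \<le> radius (Suc m)"
    by (auto simp: stage_def)
  then obtain p where p: "p \<in> level m" "p' \<in> children m p" by (auto simp: level_def)
  have "dist (pt m p) x \<le> radius m"
    using p'(2) child_pt[OF p(2)] radius_Suc[of m] radius_pos[of m]
    by (auto simp: dist_real_def abs_le_iff)
  then show "x \<in> stage m" using p(1) by (auto simp: stage_def)
qed

lemma stage_0: "stage 0 \<subseteq> {0..1}"
proof -
  have "exp (- L 0) \<le> exp (- ln 2)" using L_ge[of 0] by (simp only: exp_le_cancel_iff)
  then have "exp (- L 0) \<le> 1/2" by (simp add: exp_minus)
  then show ?thesis
    using radius_le[of 0] exp_gt_zero[of "- L 0"] by (auto simp: stage_def level_def pt_def dist_real_def abs_le_iff)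
qed

lemma pt_in_stage: "pt m ` level m \<subseteq> stage m"
  using radius_pos[of m] by (force simp: stage_def)

lemma inj_pt: "inj (pt m)"
  by (auto simp: inj_def pt_def)

text \<open>Cross-multiplied to avoid division. All subtrees rooted at level \<open>j\<close> have
  equal size, so the share of level \<open>m\<close> near \<open>x\<close> is at most the share of
  level \<open>j\<close> nodes whose subtree can reach there. These are integers in a window of
  length \<open>(2 * r + radius j) * exp (L j)\<close>.\<close>

lemma card_level_near:
  assumes "j \<le> m" "0 \<le> r"
  shows "real (card {p \<in> level m. \<bar>pt m p - x\<bar> \<le> r}) * card (level j) \<le>
    ((2 * r + radius j) * exp (L j) + 1) * card (level m)"
proof -
  \<comment> \<open>Descendants lie to the right of their ancestor and within
    \<open>radius j\<close> of it, so the window is extended only to the left.\<close>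
  define S where "S = {p \<in> level j. x - r - radius j \<le> pt j p \<and> pt j p \<le> x + r}"
  have "finite S" using finite_level by (simp add: S_def)
  have "{p \<in> level m. \<bar>pt m p - x\<bar> \<le> r} \<subseteq> descend j (m - j) S"
  proof safe
    fix p' assume p': "p' \<in> level m" "\<bar>pt m p' - x\<bar> \<le> r"
    then obtain p where p: "p \<in> level j" "p' \<in> descend j (m - j) {p}"
      using descend_singleton[of p' j "m - j" "level j"] unfolding level_descend[OF assms(1)] by blast
    have "pt j p \<le> pt m p'" "pt m p' + radius m \<le> pt j p + radius j"
      using descend_pt[OF p(2)] assms(1) by auto
    then have "x - r - radius j \<le> pt j p \<and> pt j p \<le> x + r"
      using p'(2) radius_pos[of m] by linarith
    then have "p \<in> S" using p(1) by (simp add: S_def)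
    then show "p' \<in> descend j (m - j) S" using subsetD[OF descend_mono p(2), of S] by simp
  qed
  then have "card {p \<in> level m. \<bar>pt m p - x\<bar> \<le> r} \<le> card (descend j (m - j) S)"
    by (intro card_mono finite_descend \<open>finite S\<close>)
  also have "\<dots> = card S * (\<Prod>l<m - j. nchild (j + l))" by (rule card_descend[OF \<open>finite S\<close>])
  finally have "card {p \<in> level m. \<bar>pt m p - x\<bar> \<le> r} * card (level j) \<le>
      card S * ((\<Prod>l<m - j. nchild (j + l)) * card (level j))"
    unfolding mult.assoc[symmetric] by (rule mult_le_mono1)
  also have "(\<Prod>l<m - j. nchild (j + l)) * card (level j) = card (level m)"
    using card_descend[OF finite_level[of j], of j "m - j"] level_descend[OF assms(1)] by simp
  finally have *: "card {p \<in> level m. \<bar>pt m p - x\<bar> \<le> r} * card (level j) \<le> card S * card (level m)" .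
  have "S \<subseteq> {p. (x - r - radius j) * exp (L j) \<le> real_of_int p \<and> real_of_int p \<le> (x + r) * exp (L j)}"
  proof safe
    fix p assume "p \<in> S"
    then have "(x - r - radius j) * exp (L j) \<le> pt j p * exp (L j)" "pt j p * exp (L j) \<le> (x + r) * exp (L j)"
      by (simp_all add: S_def)
    moreover have "pt j p * exp (L j) = real_of_int p" by (simp add: pt_def exp_minus)
    ultimately show "(x - r - radius j) * exp (L j) \<le> real_of_int p" "real_of_int p \<le> (x + r) * exp (L j)"
      by simp_all
  qed
  then have "card S \<le> card {p. (x - r - radius j) * exp (L j) \<le> real_of_int p \<and> real_of_int p \<le> (x + r) * exp (L j)}"
    by (intro card_mono finite_int_interval)
  also have "real \<dots> \<le> (x + r) * exp (L j) - (x - r - radius j) * exp (L j) + 1"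
  proof (rule card_int_interval)
    have "(x - r - radius j) * exp (L j) \<le> (x + r) * exp (L j)"
      using assms(2) radius_pos[of j] by (intro mult_right_mono) auto
    then show "(x - r - radius j) * exp (L j) \<le> (x + r) * exp (L j) + 1" by linarith
  qed
  also have "\<dots> = (2 * r + radius j) * exp (L j) + 1" by (simp add: algebra_simps)
  finally have S: "real (card S) \<le> (2 * r + radius j) * exp (L j) + 1" by simp
  have "real (card {p \<in> level m. \<bar>pt m p - x\<bar> \<le> r}) * card (level j) \<le> real (card S) * card (level m)"
    using * by (simp flip: of_nat_mult)
  also have "\<dots> \<le> ((2 * r + radius j) * exp (L j) + 1) * card (level m)"
    by (intro mult_right_mono S) auto
  finally show ?thesis .
qed

text \<open>Counting at level \<open>j\<close> gives the bound with 1. Counting at level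
  \<open>Suc j\<close> gives at most \<open>4 * r * exp (L (Suc j))\<close> nodes; dividing by
  \<open>nchild j\<close>, with its lower bound containing \<open>1 / 8\<close>, gives the other
  term and the constant 32.\<close>

lemma card_level_near_min:
  assumes "Suc j \<le> m" "exp (- L (Suc j)) \<le> r" "r \<le> exp (- L j)"
  shows "real (card {p \<in> level m. \<bar>pt m p - x\<bar> \<le> r}) * card (level j) \<le>
    32 * min 1 (r * exp ((1 + \<tau>) * L j)) * card (level m)"
proof -
  have r: "r > 0" using assms(2) exp_gt_zero[of "- L (Suc j)"] by linarith
  have rad: "radius i * exp (L i) \<le> 1/2" for i
  proof -
    have "radius i * exp (L i) \<le> exp (- L i) / 2 * exp (L i)"
      by (intro mult_right_mono radius_le) auto
    also have "\<dots> = 1/2" by (simp add: exp_minus)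
    finally show ?thesis .
  qed
  have "r * exp (L j) \<le> exp (- L j) * exp (L j)"
    using assms(3) by (intro mult_right_mono) auto
  then have "r * exp (L j) \<le> 1" by (simp add: exp_minus)
  then have "(2 * r + radius j) * exp (L j) + 1 \<le> 32"
    using rad[of j] by (simp add: algebra_simps)
  then have "((2 * r + radius j) * exp (L j) + 1) * card (level m) \<le> 32 * real (card (level m))"
    by (intro mult_right_mono) auto
  then have 1: "real (card {p \<in> level m. \<bar>pt m p - x\<bar> \<le> r}) * card (level j) \<le> 32 * card (level m)"
    using card_level_near[of j m r x] assms(1) r by simp
  have "exp (- L (Suc j)) * exp (L (Suc j)) \<le> r * exp (L (Suc j))"
    using assms(2) by (intro mult_right_mono) auto
  then have "1 \<le> r * exp (L (Suc j))" by (simp add: exp_minus)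
  then have "(2 * r + radius (Suc j)) * exp (L (Suc j)) + 1 \<le> 4 * (r * exp (L (Suc j)))"
    using rad[of "Suc j"] by (simp add: algebra_simps)
  also have "\<dots> = 32 * (r * exp ((1 + \<tau>) * L j)) * (exp (L (Suc j) - (1 + \<tau>) * L j) / 8)"
    by (simp add: exp_diff)
  also have "\<dots> \<le> 32 * (r * exp ((1 + \<tau>) * L j)) * real (nchild j)"
    using r by (intro mult_left_mono nchild_bounds) auto
  finally have "((2 * r + radius (Suc j)) * exp (L (Suc j)) + 1) * card (level m)
      \<le> 32 * (r * exp ((1 + \<tau>) * L j)) * real (nchild j) * card (level m)"
    by (intro mult_right_mono) auto
  then have "real (card {p \<in> level m. \<bar>pt m p - x\<bar> \<le> r}) * card (level (Suc j)) \<le>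
      32 * (r * exp ((1 + \<tau>) * L j)) * real (nchild j) * card (level m)"
    using card_level_near[of "Suc j" m r x] assms(1) r by simp
  then have "(real (card {p \<in> level m. \<bar>pt m p - x\<bar> \<le> r}) * card (level j)) * real (nchild j) \<le>
      (32 * (r * exp ((1 + \<tau>) * L j)) * card (level m)) * real (nchild j)"
    by (simp add: card_level mult_ac)
  then have 2: "real (card {p \<in> level m. \<bar>pt m p - x\<bar> \<le> r}) * card (level j) \<le>
      32 * (r * exp ((1 + \<tau>) * L j)) * card (level m)"
    by (rule mult_right_le_imp_le) (use nchild_pos[of j] in simp)
  show ?thesis using 1 2 by (simp add: min_def)
qed

text \<open>The lower bounds for \<open>nchild\<close> multiply to a telescoping product; the factor
  \<open>1 / 8\<close> lost at each level is absorbed by \<open>\<epsilon> * L l\<close>.\<close>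

lemma card_level_ge:
  assumes "\<And>l. ln 8 \<le> \<epsilon> * L l"
  shows "exp (L j - L 0 - (\<tau> + \<epsilon>) * (\<Sum>l<j. L l)) \<le> real (card (level j))"
proof (induction j)
  case (Suc j)
  have "exp (L (Suc j) - L 0 - (\<tau> + \<epsilon>) * (\<Sum>l<Suc j. L l)) =
      exp (L j - L 0 - (\<tau> + \<epsilon>) * (\<Sum>l<j. L l)) * exp (L (Suc j) - (1 + \<tau>) * L j - \<epsilon> * L j)"
    by (simp add: algebra_simps flip: exp_add)
  also have "\<dots> \<le> exp (L j - L 0 - (\<tau> + \<epsilon>) * (\<Sum>l<j. L l)) * exp (L (Suc j) - (1 + \<tau>) * L j - ln 8)"
    using assms[of j] by (intro mult_left_mono) auto
  also have "exp (L (Suc j) - (1 + \<tau>) * L j - ln 8) = exp (L (Suc j) - (1 + \<tau>) * L j) / 8"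
    by (subst exp_diff) simp
  also have "exp (L j - L 0 - (\<tau> + \<epsilon>) * (\<Sum>l<j. L l)) * \<dots> \<le> real (card (level j)) * real (nchild j)"
    by (intro mult_mono Suc.IH nchild_bounds) auto
  finally show ?case by (simp add: card_level mult_ac)
qed (simp add: card_level)

end

section \<open>Covering the approximable numbers\<close>

lemma infdist_int_less:
  assumes "infdist y \<int> < (e::real)"
  obtains p :: int where "\<bar>y - real_of_int p\<bar> < e"
proof -
  have "(\<int>::real set) \<noteq> {}" using Ints_0 by blast
  then have "(INF a\<in>\<int>. dist y a) < e" using assms by (simp add: infdist_notempty)
  then obtain a where "a \<in> \<int>" "dist y a < e"
    using \<open>\<int> \<noteq> {}\<close> by (subst (asm) cINF_less_iff) (auto intro: bdd_belowI2[of _ 0])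
  then show thesis using that by (auto simp: Ints_def dist_real_def)
qed

text \<open>Induction on the level: an interval of radius \<open>w\<close> meets at most
  \<open>5 * w * exp (L (Suc j))\<close> intervals of the next level, and the factor 5 is absorbed
  by \<open>exp (\<epsilon> * L j)\<close>.\<close>

lemma approximable_cover:
  fixes L :: "nat \<Rightarrow> real" and \<tau> \<epsilon> :: real
  assumes "0 \<le> \<tau>" and L0: "\<And>l. 0 \<le> L l"
    and growth: "\<And>l. (1 + \<tau>) * L l \<le> L (Suc l)" and eps: "\<And>l. ln 5 \<le> \<epsilon> * L l"
  shows "\<exists>Y. finite Y \<and>
    {x. 0 \<le> x \<and> x \<le> 1 \<and> (\<forall>j. infdist (exp (L j) * x) \<int> < exp (- \<tau> * L j))} \<subseteq>
      (\<Union>y\<in>Y. cball y (exp (- (1 + \<tau>) * L j))) \<and>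
    real (card Y) \<le> 4 * exp (L j - (\<tau> - \<epsilon>) * (\<Sum>l<j. L l))"
    (is "\<exists>Y. finite Y \<and> ?F \<subseteq> _ \<and> _")
proof (induction j)
  case 0
  \<comment> \<open>For \<open>x\<close> in the unit interval the numerator is within 1 of the range
    from 0 to \<open>exp (L 0)\<close>. There are at most
    \<open>exp (L 0) + 3 \<le> 4 * exp (L 0)\<close> such integers.\<close>
  define I where "I = {p::int. -1 \<le> real_of_int p \<and> real_of_int p \<le> exp (L 0) + 1}"
  define Y where "Y = (\<lambda>p. real_of_int p * exp (- L 0)) ` I"
  have "finite I" unfolding I_def by (rule finite_int_interval)
  have "x \<in> (\<Union>y\<in>Y. cball y (exp (- (1 + \<tau>) * L 0)))" if x: "x \<in> ?F" for x
  proof -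
    obtain p where p: "\<bar>exp (L 0) * x - real_of_int p\<bar> < exp (- \<tau> * L 0)"
      using infdist_int_less x by blast
    also have "\<dots> \<le> 1" using L0[of 0] \<open>0 \<le> \<tau>\<close> by (simp add: mult_nonneg_nonneg)
    finally have "\<bar>exp (L 0) * x - real_of_int p\<bar> < 1" .
    moreover have "0 \<le> exp (L 0) * x" "exp (L 0) * x \<le> exp (L 0) * 1"
      using x by (auto intro!: mult_left_mono)
    ultimately have "p \<in> I" unfolding I_def mem_Collect_eq mult_1_right by linarith
    have "\<bar>exp (L 0) * x - real_of_int p\<bar> * exp (- L 0) \<le> exp (- \<tau> * L 0) * exp (- L 0)"
      using p by (intro mult_right_mono) auto
    also have "\<dots> = exp (- (1 + \<tau>) * L 0)" by (simp add: algebra_simps flip: exp_add)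
    also have "\<bar>exp (L 0) * x - real_of_int p\<bar> * exp (- L 0) = \<bar>(exp (L 0) * x - real_of_int p) * exp (- L 0)\<bar>"
      by (simp add: abs_mult)
    also have "(exp (L 0) * x - real_of_int p) * exp (- L 0) = x - real_of_int p * exp (- L 0)"
      by (simp add: left_diff_distrib exp_minus)
    finally show ?thesis using \<open>p \<in> I\<close> by (auto simp: Y_def dist_real_def abs_minus_commute)
  qed
  moreover have "real (card Y) \<le> 4 * exp (L 0)"
  proof -
    have "real (card Y) \<le> real (card I)"
      unfolding Y_def using card_image_le[OF \<open>finite I\<close>] by simp
    also have "\<dots> \<le> (exp (L 0) + 1) - (-1) + 1"
      unfolding I_def by (intro card_int_interval) (smt (verit) exp_gt_zero)
    also have "\<dots> \<le> 4 * exp (L 0)" using one_le_exp_iff[of "L 0"] L0[of 0] by linarith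
    finally show ?thesis .
  qed
  ultimately show ?case using \<open>finite I\<close> by (intro exI[of _ Y]) (auto simp: Y_def)
next
  case (Suc j)
  then obtain Y where Y: "finite Y" "?F \<subseteq> (\<Union>y\<in>Y. cball y (exp (- (1 + \<tau>) * L j)))"
    "real (card Y) \<le> 4 * exp (L j - (\<tau> - \<epsilon>) * (\<Sum>l<j. L l))" by blast
  define w where "w = exp (- (1 + \<tau>) * L j)"
  define w' where "w' = exp (- (1 + \<tau>) * L (Suc j))"
  have "L j \<le> L (Suc j)"
    using growth[of j] mult_nonneg_nonneg[OF \<open>0 \<le> \<tau>\<close> L0[of j]] by (simp add: algebra_simps)
  then have w': "w' \<le> w" using \<open>0 \<le> \<tau>\<close> by (simp add: w_def w'_def mult_left_mono)
  define E where "E = exp (L (Suc j))"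
  have "E > 0" by (simp add: E_def)
  have wE: "w * E = exp (L (Suc j) - (1 + \<tau>) * L j)"
    by (simp add: w_def E_def algebra_simps flip: exp_add)
  then have wE1: "w * E \<ge> 1" using growth[of j] by simp
  \<comment> \<open>Numerators \<open>p\<close> for which the ball of radius \<open>w'\<close>
    around \<open>p / E\<close> can meet the ball of radius \<open>w\<close> around
    \<open>y\<close>. Their number is at most \<open>2 * (w + w') * E + 1\<close>, where
    \<open>w' \<le> w\<close> and \<open>1 \<le> w * E\<close>.\<close>
  define I where "I = (\<lambda>y. {p::int. (y - w - w') * E \<le> real_of_int p \<and> real_of_int p \<le> (y + w + w') * E})"
  have finI: "finite (I y)" for y unfolding I_def by (rule finite_int_interval)
  have cardI: "real (card (I y)) \<le> 5 * (w * E)" for y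
  proof -
    have ww: "w' * E \<le> w * E" "0 \<le> w' * E" using w' \<open>E > 0\<close> by (auto simp: w'_def)
    have "real (card (I y)) \<le> (y + w + w') * E - (y - w - w') * E + 1"
      unfolding I_def using ww wE1 by (intro card_int_interval) (simp add: algebra_simps)
    also have "\<dots> \<le> 5 * (w * E)" using ww wE1 by (simp add: algebra_simps)
    finally show ?thesis .
  qed
  define Y' where "Y' = (\<Union>y\<in>Y. (\<lambda>p. real_of_int p / E) ` I y)"
  have "x \<in> (\<Union>y\<in>Y'. cball y w')" if x: "x \<in> ?F" for x
  proof -
    obtain y where y: "y \<in> Y" "\<bar>y - x\<bar> \<le> w" using Y(2) x by (auto simp: w_def dist_real_def)
    obtain p where p: "\<bar>E * x - real_of_int p\<bar> < exp (- \<tau> * L (Suc j))"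
      using infdist_int_less x unfolding E_def by blast
    also have "\<dots> = w' * E" by (simp add: w'_def E_def algebra_simps flip: exp_add)
    finally have "\<bar>E * x - real_of_int p\<bar> \<le> w' * E" by simp
    moreover have "\<bar>E * x - real_of_int p\<bar> = E * \<bar>x - real_of_int p / E\<bar>"
      using \<open>E > 0\<close> by (simp add: abs_mult_pos' right_diff_distrib)
    ultimately have d: "\<bar>x - real_of_int p / E\<bar> \<le> w'" using \<open>E > 0\<close> by (simp add: mult.commute)
    then have "y - w - w' \<le> real_of_int p / E" "real_of_int p / E \<le> y + w + w'" using y(2) by linarith+
    then have "p \<in> I y" using \<open>E > 0\<close> by (simp add: I_def field_simps)
    then have "real_of_int p / E \<in> Y'" using y(1) by (auto simp: Y'_def)
    then show ?thesis using d by (intro UN_I) (auto simp: dist_real_def abs_minus_commute)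
  qed
  moreover have "finite Y'" using Y(1) finI by (simp add: Y'_def)
  moreover have "real (card Y') \<le> 4 * exp (L (Suc j) - (\<tau> - \<epsilon>) * (\<Sum>l<Suc j. L l))"
  proof -
    have "card Y' \<le> (\<Sum>y\<in>Y. card ((\<lambda>p. real_of_int p / E) ` I y))"
      unfolding Y'_def by (rule card_UN_le[OF Y(1)])
    also have "\<dots> \<le> (\<Sum>y\<in>Y. card (I y))" by (intro sum_mono card_image_le finI)
    finally have "real (card Y') \<le> (\<Sum>y\<in>Y. real (card (I y)))" by (simp flip: of_nat_sum)
    also have "\<dots> \<le> (\<Sum>y\<in>Y. 5 * (w * E))" by (intro sum_mono cardI)
    also have "\<dots> = real (card Y) * (5 * (w * E))" by simp
    also have "\<dots> \<le> (4 * exp (L j - (\<tau> - \<epsilon>) * (\<Sum>l<j. L l))) * (exp (\<epsilon> * L j) * (w * E))"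
    proof (intro mult_mono Y(3))
      have "exp (ln 5) \<le> exp (\<epsilon> * L j)" using eps[of j] by (simp only: exp_le_cancel_iff)
      then show "5 \<le> exp (\<epsilon> * L j)" by simp
    qed (use wE1 in \<open>auto simp: w_def E_def\<close>)
    also have "\<dots> = 4 * exp (L (Suc j) - (\<tau> - \<epsilon>) * (\<Sum>l<Suc j. L l))"
      unfolding wE by (simp add: algebra_simps flip: exp_add)
    finally show ?thesis .
  qed
  ultimately show ?case by (intro exI[of _ Y']) (auto simp: w'_def)
qed

text \<open>The summand 2 takes care of \<open>w < \<rho>\<close>, so directions with intervals
  longer and shorter than the cubes are treated alike.\<close>

lemma cball_refine:
  fixes Y :: "real set" and w \<rho> :: real
  assumes "finite Y" "\<rho> > 0" "w \<ge> 0"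
  shows "\<exists>Z. finite Z \<and> (\<Union>y\<in>Y. cball y w) \<subseteq> (\<Union>z\<in>Z. cball z \<rho>) \<and>
    real (card Z) \<le> real (card Y) * (2 * (w / \<rho>) + 2)"
proof -
  define I where "I = {p::int. - (w / \<rho> + 1/2) \<le> real_of_int p \<and> real_of_int p \<le> w / \<rho> + 1/2}"
  have "finite I" unfolding I_def by (rule finite_int_interval)
  have "w / \<rho> \<ge> 0" using assms by simp
  then have "real (card I) \<le> (w / \<rho> + 1/2) - - (w / \<rho> + 1/2) + 1"
    unfolding I_def by (intro card_int_interval) linarith
  then have I: "real (card I) \<le> 2 * (w / \<rho>) + 2" by simp
  define Z where "Z = (\<lambda>(y, p). y + real_of_int p * \<rho>) ` (Y \<times> I)"
  have "x \<in> (\<Union>z\<in>Z. cball z \<rho>)" if x: "y \<in> Y" "dist y x \<le> w" for x y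
  proof -
    \<comment> \<open>The point of the grid with mesh \<open>\<rho>\<close> through \<open>y\<close>
      that is nearest to \<open>x\<close>.\<close>
    define p where "p = round ((x - y) / \<rho>)"
    have p: "\<bar>real_of_int p - (x - y) / \<rho>\<bar> \<le> 1/2" unfolding p_def by (rule of_int_round_abs_le)
    have "\<bar>(x - y) / \<rho>\<bar> \<le> w / \<rho>"
      using x(2) \<open>\<rho> > 0\<close> by (simp add: dist_real_def abs_minus_commute divide_right_mono)
    then have "p \<in> I" unfolding I_def mem_Collect_eq using p by linarith
    then have pZ: "y + real_of_int p * \<rho> \<in> Z" using x(1) by (force simp: Z_def)
    have "\<bar>real_of_int p - (x - y) / \<rho>\<bar> * \<rho> \<le> 1/2 * \<rho>"
      using \<open>\<rho> > 0\<close> p by (intro mult_right_mono) auto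
    then have "\<bar>(real_of_int p - (x - y) / \<rho>) * \<rho>\<bar> \<le> \<rho>"
      using \<open>\<rho> > 0\<close> unfolding abs_mult by simp
    moreover have "(real_of_int p - (x - y) / \<rho>) * \<rho> = y + real_of_int p * \<rho> - x"
      using \<open>\<rho> > 0\<close> by (simp add: field_simps)
    ultimately have "\<bar>y + real_of_int p * \<rho> - x\<bar> \<le> \<rho>" by simp
    with pZ show ?thesis by (intro UN_I) (auto simp: dist_real_def)
  qed
  moreover have "finite Z" using assms(1) \<open>finite I\<close> by (simp add: Z_def)
  moreover have "real (card Z) \<le> real (card Y) * (2 * (w / \<rho>) + 2)"
  proof -
    have "card Z \<le> card Y * card I"
      unfolding Z_def using card_image_le[of "Y \<times> I"] assms(1) \<open>finite I\<close>
      by (metis card_cartesian_product finite_cartesian_product)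
    then have "real (card Z) \<le> real (card Y) * real (card I)" by (metis of_nat_le_iff of_nat_mult)
    also have "\<dots> \<le> real (card Y) * (2 * (w / \<rho>) + 2)" by (intro mult_left_mono I) auto
    finally show ?thesis .
  qed
  ultimately show ?thesis by (intro exI[of _ Z]) auto
qed

section \<open>Boxes in Euclidean space\<close>

lemma bij_betw_vec_nth_PiE:
  "bij_betw vec_nth {v :: 'a ^ 'n. \<forall>i. v $ i \<in> S i} (PiE UNIV S)"
  by (rule bij_betwI[where g = vec_lambda]) (auto simp: PiE_iff)

lemma card_vec_box:
  "card {v :: 'a ^ 'n. \<forall>i. v $ i \<in> S i} = (\<Prod>i\<in>UNIV. card (S i))"
  using bij_betw_same_card[OF bij_betw_vec_nth_PiE[of S]] by (simp add: card_PiE)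

lemma finite_vec_box:
  "(\<And>i. finite (S i)) \<Longrightarrow> finite {v :: 'a ^ 'n. \<forall>i. v $ i \<in> S i}"
  using bij_betw_finite[OF bij_betw_vec_nth_PiE[of S]] by (simp add: finite_PiE)

text \<open>The Euclidean norm is at most the sum of the absolute coordinates, which costs only a
  constant factor depending on the dimension.\<close>

lemma diameter_cube:
  fixes z :: "real ^ 'n" and \<rho> :: real
  assumes "\<rho> \<ge> 0"
  shows "bounded {x. \<forall>i. \<bar>x $ i - z $ i\<bar> \<le> \<rho>}"
    "diameter {x. \<forall>i. \<bar>x $ i - z $ i\<bar> \<le> \<rho>} \<le> 2 * CARD('n) * \<rho>"
proof -
  have norm_le: "norm v \<le> CARD('n) * c" if "\<And>i. \<bar>v $ i\<bar> \<le> c" for v :: "real ^ 'n" and c :: real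
  proof -
    have "norm v \<le> (\<Sum>i\<in>UNIV. \<bar>v $ i\<bar>)" by (rule norm_le_l1_cart)
    also have "\<dots> \<le> sum (\<lambda>_. c) (UNIV :: 'n set)" by (intro sum_mono that)
    finally show ?thesis by simp
  qed
  show "bounded {x. \<forall>i. \<bar>x $ i - z $ i\<bar> \<le> \<rho>}"
    by (rule bounded_subset[OF bounded_cball[of z "CARD('n) * \<rho>"]])
      (auto simp: dist_norm norm_minus_commute intro!: norm_le)
  show "diameter {x. \<forall>i. \<bar>x $ i - z $ i\<bar> \<le> \<rho>} \<le> 2 * CARD('n) * \<rho>"
  proof (rule diameter_le)
    fix x y assume "x \<in> {x. \<forall>i. \<bar>x $ i - z $ i\<bar> \<le> \<rho>}" "y \<in> {x. \<forall>i. \<bar>x $ i - z $ i\<bar> \<le> \<rho>}"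
    then have x: "\<And>i. \<bar>x $ i - z $ i\<bar> \<le> \<rho>" and y: "\<And>i. \<bar>y $ i - z $ i\<bar> \<le> \<rho>" by auto
    have "\<bar>(x - y) $ i\<bar> \<le> 2 * \<rho>" for i using x[of i] y[of i] by (simp add: abs_le_iff)
    then have "norm (x - y) \<le> CARD('n) * (2 * \<rho>)" by (rule norm_le)
    then show "norm (x - y) \<le> 2 * CARD('n) * \<rho>" by (simp add: mult_ac)
  qed (use assms in auto)
qed

section \<open>Bounds for the dimension\<close>

text \<open>The points \<open>V m\<close> are products of tree levels, so the mass of a ball is
  bounded by a product over the coordinates. Writing the radius as \<open>exp (- u * L j)\<close>,
  the inequality \<open>key\<close> is what makes this product at most a constant times
  \<open>r powr s\<close>.\<close>

lemma hausdorff_measure_nonzero_of_trees: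
  fixes L :: "nat \<Rightarrow> real" and \<tau> :: "real ^ 'n"
  assumes tree: "\<And>i. cantor_tree L (\<tau> $ i)"
    and eps: "\<And>l. ln 8 \<le> \<epsilon> * L l" "0 \<le> \<epsilon>"
    and \<kappa>: "1 < \<kappa>" "\<And>l. \<kappa> * L l \<le> L (Suc l)"
    and "s > 0"
    and key: "\<And>u. 1 \<le> u \<Longrightarrow> s * u \<le>
      CARD('n) - (\<Sum>i\<in>UNIV. \<tau> $ i + \<epsilon>) / (\<kappa> - 1) + (\<Sum>i\<in>UNIV. max 0 (u - 1 - \<tau> $ i))"
    and sub: "\<And>x. (\<And>i m. x $ i \<in> cantor_tree.stage L (\<tau> $ i) m) \<Longrightarrow> x \<in> A"
  shows "hausdorff_measure s A \<noteq> 0"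
proof -
  interpret t: cantor_tree L "\<tau> $ i" for i by (rule tree)
  \<comment> \<open>One factor 32 per coordinate comes from \<open>card_level_near_min\<close>, and
    one factor \<open>exp (L 0)\<close> from the term \<open>L 0\<close> in
    \<open>card_level_ge\<close>.\<close>
  define C where "C = 32 ^ CARD('n) * exp (CARD('n) * L 0)"
  define V where "V = (\<lambda>m. {v :: real ^ 'n. \<forall>i. v $ i \<in> t.pt m ` t.level i m})"
  define K where "K = (\<lambda>m. {v :: real ^ 'n. \<forall>i. v $ i \<in> t.stage i m})"
  have finV: "finite (t.pt m ` t.level i m)" for m i by (intro finite_imageI t.finite_level)
  have cardV: "card (V m) = (\<Prod>i\<in>UNIV. card (t.level i m))" for m
    unfolding V_def card_vec_box by (intro prod.cong refl card_image inj_on_subset[OF t.inj_pt]) auto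
  have stage_unit: "t.stage i m \<subseteq> {0..1}" for i m
    using lift_Suc_antimono_le[of "t.stage i" 0 m] t.stage_Suc t.stage_0 by blast
  have L_large: "\<exists>j. c \<le> L j" for c
  proof -
    have "j * ln 4 \<le> L j" for j
    proof (induction j)
      case (Suc j)
      then show ?case using t.growth'[of j] by (simp add: algebra_simps)
    qed (use t.L_pos[of 0] in simp)
    moreover obtain j where "c < real j * ln 4" using reals_Archimedean3[of "ln 4 :: real"] by auto
    ultimately show ?thesis by (meson less_imp_le order_trans)
  qed
  show ?thesis
  proof (rule hausdorff_measure_nonzero[of s "exp (- L 0)" C K A V])
    show "s > 0" by fact
    show "C > 0" by (simp add: C_def)
    show "finite (V m)" for m unfolding V_def by (intro finite_vec_box finV)
    show "V m \<noteq> {}" for m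
    proof -
      have "card (V m) > 0" unfolding cardV by (intro prod_pos) (simp add: t.card_level_pos)
      then show ?thesis by auto
    qed
    show "V m \<subseteq> K m" for m using t.pt_in_stage by (fastforce simp: V_def K_def)
    show "K (Suc m) \<subseteq> K m" for m using t.stage_Suc by (fastforce simp: K_def)
    show "(\<Inter>m. K m) \<subseteq> A" using sub by (auto simp: K_def)
    show "compact (K m)" for m
    proof -
      \<comment> \<open>Compactness comes from the unit cube; the stages contribute closed
        preimages.\<close>
      have "K m = cbox 0 1 \<inter> (\<Inter>i. (\<lambda>v. v $ i) -` t.stage i m)"
        using stage_unit by (fastforce simp: K_def mem_box_cart)
      also have "compact \<dots>"
        by (intro compact_Int_closed compact_cbox closed_INT ballI closed_vimage compact_imp_closed t.compact_stage)
          (auto intro: continuous_intros)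
      finally show ?thesis .
    qed
    fix x :: "real ^ 'n" and r :: real
    assume r: "0 < r" "r \<le> exp (- L 0)"
    \<comment> \<open>The level with \<open>exp (- L (Suc j)) \<le> r \<le> exp (- L j)\<close>. For
      \<open>j = 0\<close> the upper bound is the assumption on \<open>r\<close>, otherwise it is
      minimality.\<close>
    define j where "j = (LEAST j. exp (- L (Suc j)) \<le> r)"
    obtain j0 where "- ln r \<le> L j0" using L_large by blast
    also have "\<dots> \<le> L (Suc j0)" using t.growth'[of j0] by (smt (verit) ln_gt_zero)
    finally have "exp (- L (Suc j0)) \<le> r" using r(1) by (simp add: ln_ge_iff[symmetric])
    then have j1: "exp (- L (Suc j)) \<le> r" unfolding j_def by (rule LeastI)
    have j2: "r \<le> exp (- L j)"
    proof (cases j)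
      case (Suc j')
      then show ?thesis using not_less_Least[of j' "\<lambda>j. exp (- L (Suc j)) \<le> r"] by (auto simp: j_def)
    qed (use r in simp)
    define u where "u = - ln r / L j"
    have Lj: "L j > 0" by (rule t.L_pos)
    have lnr: "ln r = - u * L j" using Lj by (simp add: u_def)
    then have r_exp: "r = exp (- u * L j)" using r(1) by (metis exp_ln)
    have "u \<ge> 1"
      using j2 Lj unfolding r_exp exp_le_cancel_iff by (simp add: mult_le_cancel_right1)
    have Lsum: "(\<Sum>l<j. L l) \<le> L j / (\<kappa> - 1)"
      by (intro sum_le_of_growth \<kappa> less_imp_le[OF t.L_pos])
    define b where "b = (\<lambda>i. L j - L 0 - (\<tau> $ i + \<epsilon>) * (L j / (\<kappa> - 1)))"
    have N: "exp (b i) \<le> card (t.level i j)" for i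
    proof -
      have "(\<tau> $ i + \<epsilon>) * (\<Sum>l<j. L l) \<le> (\<tau> $ i + \<epsilon>) * (L j / (\<kappa> - 1))"
        using Lsum t.tau_pos[of i] eps(2) by (intro mult_left_mono) auto
      then have "exp (b i) \<le> exp (L j - L 0 - (\<tau> $ i + \<epsilon>) * (\<Sum>l<j. L l))" by (simp add: b_def)
      also have "\<dots> \<le> card (t.level i j)" by (rule t.card_level_ge[OF eps(1)])
      finally show ?thesis .
    qed
    \<comment> \<open>\<open>exp (- L j * M i)\<close> is the share of a level \<open>j\<close>
      interval in direction \<open>i\<close> that a shorter ball can catch.\<close>
    define M where "M = (\<lambda>i. max 0 (u - 1 - \<tau> $ i))"
    have min_le: "min 1 (r * exp ((1 + \<tau> $ i) * L j)) \<le> exp (- L j * M i)" for i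
    proof (cases "u - 1 - \<tau> $ i \<ge> 0")
      case True
      have "r * exp ((1 + \<tau> $ i) * L j) = exp (- L j * M i)"
        using True unfolding r_exp M_def by (simp add: algebra_simps flip: exp_add)
      then show ?thesis by simp
    qed (simp add: M_def)
    \<comment> \<open>This is \<open>key\<close> multiplied by \<open>- L j\<close>, with the
      constants from \<open>L 0\<close> split off.\<close>
    have exponent: "(\<Sum>i\<in>UNIV. - L j * M i - b i) \<le> CARD('n) * L 0 - s * u * L j"
    proof -
      define T where "T = (\<Sum>i\<in>UNIV. \<tau> $ i + \<epsilon>)"
      have "(\<Sum>i\<in>UNIV. - L j * M i - b i) =
          - L j * (\<Sum>i\<in>UNIV. M i) - (CARD('n) * L j - CARD('n) * L 0 - T * (L j / (\<kappa> - 1)))"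
        by (simp only: b_def T_def sum_subtractf sum_distrib_left[symmetric]
            sum_distrib_right[symmetric] sum_constant)
      also have "\<dots> = CARD('n) * L 0 - L j * (CARD('n) - T / (\<kappa> - 1) + (\<Sum>i\<in>UNIV. M i))"
        by (simp add: algebra_simps)
      also have "\<dots> \<le> CARD('n) * L 0 - L j * (s * u)"
        using key[OF \<open>u \<ge> 1\<close>] Lj unfolding M_def T_def by (intro diff_left_mono mult_left_mono) auto
      finally show ?thesis by (simp add: mult_ac)
    qed
    show "\<forall>\<^sub>F m in sequentially. real (card (V m \<inter> ball x r)) \<le> C * r powr s * real (card (V m))"
      using eventually_ge_at_top[of "Suc j"]
    proof eventually_elim
      case (elim m)
      define near where "near = (\<lambda>i. {p \<in> t.level i m. \<bar>t.pt m p - x $ i\<bar> \<le> r})"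
      have fin_near: "finite (near i)" for i using t.finite_level by (simp add: near_def)
      \<comment> \<open>The ball lies in the cube of half-side \<open>r\<close>, where the count
        factors over the coordinates.\<close>
      have "V m \<inter> ball x r \<subseteq> {v. \<forall>i. v $ i \<in> t.pt m ` near i}"
      proof safe
        fix v i assume v: "v \<in> V m" "v \<in> ball x r"
        then obtain p where p: "p \<in> t.level i m" "v $ i = t.pt m p" by (auto simp: V_def)
        have "\<bar>(v - x) $ i\<bar> \<le> norm (v - x)" by (rule component_le_norm_cart)
        also have "\<dots> \<le> r" using v(2) by (simp add: dist_norm norm_minus_commute)
        finally show "v $ i \<in> t.pt m ` near i" using p by (auto simp: near_def)
      qed
      then have "card (V m \<inter> ball x r) \<le> card {v :: real ^ 'n. \<forall>i. v $ i \<in> t.pt m ` near i}"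
        by (intro card_mono finite_vec_box finite_imageI fin_near)
      also have "\<dots> = (\<Prod>i\<in>UNIV. card (near i))"
        unfolding card_vec_box by (intro prod.cong refl card_image inj_on_subset[OF t.inj_pt]) auto
      finally have "real (card (V m \<inter> ball x r)) \<le> (\<Prod>i\<in>UNIV. real (card (near i)))"
        by (metis of_nat_le_iff of_nat_prod)
      also have "\<dots> \<le> (\<Prod>i\<in>UNIV. 32 * exp (- L j * M i - b i) * card (t.level i m))"
      proof (intro prod_mono conjI)
        fix i
        have "real (card (near i)) * exp (b i) \<le> real (card (near i)) * card (t.level i j)"
          by (intro mult_left_mono N) auto
        also have "\<dots> \<le> 32 * min 1 (r * exp ((1 + \<tau> $ i) * L j)) * card (t.level i m)"
          unfolding near_def by (rule t.card_level_near_min[OF elim j1 j2])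
        also have "\<dots> \<le> 32 * exp (- L j * M i) * card (t.level i m)"
          by (intro mult_right_mono mult_left_mono min_le) auto
        finally have "real (card (near i)) * exp (b i) \<le>
            (32 * exp (- L j * M i - b i) * card (t.level i m)) * exp (b i)"
          by (simp add: exp_diff)
        then show "real (card (near i)) \<le> 32 * exp (- L j * M i - b i) * card (t.level i m)"
          by (rule mult_right_le_imp_le) simp
      qed auto
      also have "\<dots> = 32 ^ CARD('n) * exp (\<Sum>i\<in>UNIV. - L j * M i - b i) * card (V m)"
        by (simp add: prod.distrib exp_sum cardV)
      also have "\<dots> \<le> 32 ^ CARD('n) * exp (CARD('n) * L 0 - s * u * L j) * card (V m)"
        using exponent by (intro mult_right_mono mult_left_mono) auto
      also have "\<dots> = C * r powr s * card (V m)"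
        using r(1) by (simp add: C_def powr_def lnr exp_diff exp_minus field_simps)
      finally show ?case .
    qed
  qed simp
qed

text \<open>Each level \<open>j\<close> gives a cover by cubes adapted to direction
  \<open>a\<close>. Directions with \<open>\<tau> $ i < \<tau> $ a\<close> have longer intervals
  that must be subdivided, which accounts for the sum of maxima in \<open>key\<close>.\<close>

lemma hausdorff_measure_eq_0_of_growth:
  fixes L :: "nat \<Rightarrow> real" and \<tau> :: "real ^ 'n"
  assumes L0: "\<And>l. 0 \<le> L l" and Linf: "filterlim L at_top sequentially"
    and growth: "\<And>i l. (1 + \<tau> $ i) * L l \<le> L (Suc l)"
    and eps: "\<And>l. ln 5 \<le> \<epsilon> * L l" "\<And>i. \<epsilon> \<le> \<tau> $ i" "\<And>i. 0 \<le> \<tau> $ i"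
    and \<kappa>: "1 < \<kappa>" "\<And>l. L (Suc l) \<le> \<kappa> * L l"
    and "s > 0"
    and key: "CARD('n) - (\<Sum>i\<in>UNIV. \<tau> $ i - \<epsilon>) / (\<kappa> - 1) + (\<Sum>i\<in>UNIV. max 0 (\<tau> $ a - \<tau> $ i))
      < s * (1 + \<tau> $ a)"
  shows "hausdorff_measure s {x :: real ^ 'n. \<forall>i. 0 \<le> x $ i \<and> x $ i \<le> 1 \<and>
    (\<forall>j. infdist (exp (L j) * x $ i) \<int> < exp (- \<tau> $ i * L j))} = 0" (is "hausdorff_measure s ?F = 0")
proof (rule hausdorff_measure_eq_0_finite_covers[OF \<open>s > 0\<close>])
  define n where "n = CARD('n)"
  define \<rho> where "\<rho> = (\<lambda>j. exp (- (1 + \<tau> $ a) * L j))"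
  define d where "d = (\<lambda>j. 2 * real n * \<rho> j)"
  define M where "M = (\<lambda>i. max 0 (\<tau> $ a - \<tau> $ i))"
  \<comment> \<open>The gap in \<open>key\<close>; the total cost at level \<open>j\<close> decays
    like \<open>exp (- c * L j)\<close>.\<close>
  define c where "c = s * (1 + \<tau> $ a) - (n - (\<Sum>i\<in>UNIV. \<tau> $ i - \<epsilon>) / (\<kappa> - 1) + (\<Sum>i\<in>UNIV. M i))"
  define G where "G = (\<lambda>i. {x. 0 \<le> x \<and> x \<le> 1 \<and> (\<forall>j. infdist (exp (L j) * x) \<int> < exp (- \<tau> $ i * L j))})"
  have FG: "x $ i \<in> G i" if "x \<in> ?F" for x i using that by (simp add: G_def)
  have "c > 0" using key by (simp add: c_def n_def M_def)
  \<comment> \<open>16 is 4 from \<open>approximable_cover\<close> times 4 from the subdivision; the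
    other factors come from \<open>L 0\<close> and from the diameter of a cube.\<close>
  define C where "C = 16 ^ n * exp ((\<Sum>i\<in>UNIV. \<tau> $ i - \<epsilon>) / (\<kappa> - 1) * L 0) * (2 * n) powr s"
  have cover: "\<exists>F. finite F \<and> ?F \<subseteq> \<Union>F \<and> (\<forall>B\<in>F. bounded B \<and> diameter B \<le> d j) \<and>
      real (card F) * d j powr s \<le> C * exp (- c * L j)" for j
  proof -
    define N where "N = (\<lambda>i. exp (L j - (\<tau> $ i - \<epsilon>) * ((L j - L 0) / (\<kappa> - 1)) + M i * L j))"
    have "\<exists>Z. finite Z \<and> G i
        \<subseteq> (\<Union>z\<in>Z. cball z (\<rho> j)) \<and> real (card Z) \<le> 16 * N i" for i
    proof -
      define w where "w = exp (- (1 + \<tau> $ i) * L j)"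
      have "\<rho> j > 0" "w \<ge> 0" by (simp_all add: \<rho>_def w_def)
      have "\<exists>Y. finite Y \<and> G i \<subseteq> (\<Union>y\<in>Y. cball y w) \<and>
          real (card Y) \<le> 4 * exp (L j - (\<tau> $ i - \<epsilon>) * (\<Sum>l<j. L l))"
        unfolding w_def G_def by (intro approximable_cover eps L0 growth)
      then obtain Y where Y: "finite Y"
        "G i \<subseteq> (\<Union>y\<in>Y. cball y w)"
        "real (card Y) \<le> 4 * exp (L j - (\<tau> $ i - \<epsilon>) * (\<Sum>l<j. L l))"
        by blast
      obtain Z where Z: "finite Z" "(\<Union>y\<in>Y. cball y w) \<subseteq> (\<Union>z\<in>Z. cball z (\<rho> j))"
          "real (card Z) \<le> real (card Y) * (2 * (w / \<rho> j) + 2)"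
        using cball_refine[OF Y(1), of "\<rho> j" w, OF \<open>\<rho> j > 0\<close> \<open>w \<ge> 0\<close>] by blast
      have "w / \<rho> j = exp ((\<tau> $ a - \<tau> $ i) * L j)"
        by (simp add: w_def \<rho>_def algebra_simps flip: exp_diff)
      also have "\<dots> \<le> exp (M i * L j)" using L0[of j] by (simp add: M_def mult_right_mono)
      finally have wM: "w / \<rho> j \<le> exp (M i * L j)" .
      have "1 \<le> exp (M i * L j)" using L0[of j] by (simp add: M_def)
      then have "2 * (w / \<rho> j) + 2 \<le> 4 * exp (M i * L j)" using wM by linarith
      moreover have "exp (L j - (\<tau> $ i - \<epsilon>) * (\<Sum>l<j. L l)) \<le>
          exp (L j - (\<tau> $ i - \<epsilon>) * ((L j - L 0) / (\<kappa> - 1)))"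
        \<comment> \<open>\<open>\<epsilon> \<le> \<tau> $ i\<close> makes the coefficient
          nonnegative, so the lower bound for the sum of \<open>L\<close> can be inserted.\<close>
        using eps(2)[of i] sum_ge_of_growth[of \<kappa> L j, OF \<kappa>] by (simp add: mult_left_mono del: times_divide_eq_right)
      then have "real (card Y) \<le> 4 * exp (L j - (\<tau> $ i - \<epsilon>) * ((L j - L 0) / (\<kappa> - 1)))"
        using Y(3) by linarith
      ultimately have "real (card Y) * (2 * (w / \<rho> j) + 2) \<le>
          (4 * exp (L j - (\<tau> $ i - \<epsilon>) * ((L j - L 0) / (\<kappa> - 1)))) * (4 * exp (M i * L j))"
        by (intro mult_mono) (auto simp: w_def \<rho>_def)
      also have "\<dots> = 16 * N i" unfolding N_def by (subst exp_add) simp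
      finally show ?thesis using Y(2) Z by (intro exI[of _ Z]) auto
    qed
    then obtain Z where Z: "\<And>i. finite (Z i)"
      "\<And>i. G i \<subseteq> (\<Union>z\<in>Z i. cball z (\<rho> j))"
      "\<And>i. real (card (Z i)) \<le> 16 * N i" by metis
    define F where "F = (\<lambda>z. {x :: real ^ 'n. \<forall>i. \<bar>x $ i - z $ i\<bar> \<le> \<rho> j}) ` {z. \<forall>i. z $ i \<in> Z i}"
    have "finite F" unfolding F_def by (intro finite_imageI finite_vec_box Z(1))
    moreover have "?F \<subseteq> \<Union>F"
    proof
      fix x assume x: "x \<in> ?F"
      have "\<exists>z\<in>Z i. \<bar>x $ i - z\<bar> \<le> \<rho> j" for i
        using subsetD[OF Z(2) FG[OF x], of i] by (auto simp: dist_real_def abs_minus_commute)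
      then obtain z where "\<And>i. z i \<in> Z i \<and> \<bar>x $ i - z i\<bar> \<le> \<rho> j" by metis
      then show "x \<in> \<Union>F" by (auto simp: F_def intro!: exI[of _ "vec_lambda z"])
    qed
    moreover have "bounded B \<and> diameter B \<le> d j" if "B \<in> F" for B
      using that diameter_cube[where 'n = 'n, of "\<rho> j"] by (auto simp: F_def d_def n_def \<rho>_def)
    moreover have "real (card F) * d j powr s \<le> C * exp (- c * L j)"
    proof -
      have dp: "d j powr s = (2 * n) powr s * exp (- (s * (1 + \<tau> $ a)) * L j)"
        by (simp add: d_def \<rho>_def powr_mult exp_powr_real algebra_simps)
      have "card F \<le> (\<Prod>i\<in>UNIV. card (Z i))"
        unfolding F_def card_vec_box[symmetric] by (intro card_image_le finite_vec_box Z(1))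
      then have "real (card F) \<le> (\<Prod>i\<in>UNIV. real (card (Z i)))" by (metis of_nat_le_iff of_nat_prod)
      also have "\<dots> \<le> (\<Prod>i\<in>UNIV. 16 * N i)" by (intro prod_mono conjI Z(3)) auto
      also have "\<dots> = 16 ^ n * exp (\<Sum>i\<in>UNIV. L j - (\<tau> $ i - \<epsilon>) * ((L j - L 0) / (\<kappa> - 1)) + M i * L j)"
        by (simp add: N_def exp_sum prod.distrib n_def)
      finally have "real (card F) * d j powr s \<le>
         16 ^ n * exp (\<Sum>i\<in>UNIV. L j - (\<tau> $ i - \<epsilon>) * ((L j - L 0) / (\<kappa> - 1)) + M i * L j) * d j powr s"
        by (rule mult_right_mono) simp
      also have "(\<Sum>i\<in>UNIV. L j - (\<tau> $ i - \<epsilon>) * ((L j - L 0) / (\<kappa> - 1)) + M i * L j) =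
         n * L j - (\<Sum>i\<in>UNIV. \<tau> $ i - \<epsilon>) * ((L j - L 0) / (\<kappa> - 1)) + (\<Sum>i\<in>UNIV. M i) * L j"
        by (simp only: sum.distrib sum_subtractf sum_distrib_right[symmetric] sum_constant n_def)
      also have "16 ^ n * exp (n * L j - (\<Sum>i\<in>UNIV. \<tau> $ i - \<epsilon>) * ((L j - L 0) / (\<kappa> - 1)) + (\<Sum>i\<in>UNIV. M i) * L j) * d j powr s =
          16 ^ n * (2 * n) powr s * exp ((n * L j - (\<Sum>i\<in>UNIV. \<tau> $ i - \<epsilon>) * ((L j - L 0) / (\<kappa> - 1)) + (\<Sum>i\<in>UNIV. M i) * L j) + (- (s * (1 + \<tau> $ a)) * L j))"
        unfolding dp by (subst (2) exp_add) simp
      also have "(n * L j - (\<Sum>i\<in>UNIV. \<tau> $ i - \<epsilon>) * ((L j - L 0) / (\<kappa> - 1)) + (\<Sum>i\<in>UNIV. M i) * L j) +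
             (- (s * (1 + \<tau> $ a)) * L j) = (\<Sum>i\<in>UNIV. \<tau> $ i - \<epsilon>) / (\<kappa> - 1) * L 0 + (- c * L j)"
        by (simp add: c_def algebra_simps diff_divide_distrib)
      also have "16 ^ n * (2 * n) powr s * exp \<dots> = C * exp (- c * L j)"
        by (subst exp_add) (simp add: C_def)
      finally show ?thesis .
    qed
    ultimately show ?thesis by (intro exI[of _ F]) auto
  qed
  fix \<delta> e :: real
  assume "\<delta> > 0" "e > 0"
  have decay: "((\<lambda>j. B * exp (- b * L j)) \<longlongrightarrow> 0) sequentially" if "b > 0" for B b :: real
  proof -
    have "filterlim (\<lambda>j. - b * L j) at_bot sequentially"
      using that by (intro filterlim_tendsto_neg_mult_at_bot[OF tendsto_const _ Linf]) auto
    then show ?thesis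
      by (intro tendsto_mult_right_zero filterlim_compose[OF exp_at_bot])
  qed
  have "1 + \<tau> $ a > 0" using eps(3)[of a] by simp
  then have "\<forall>\<^sub>F j in sequentially. d j < \<delta>"
    unfolding d_def \<rho>_def by (intro order_tendstoD(2)[OF decay] \<open>\<delta> > 0\<close>)
  moreover have "\<forall>\<^sub>F j in sequentially. C * exp (- c * L j) < e"
    by (intro order_tendstoD(2)[OF decay] \<open>c > 0\<close> \<open>e > 0\<close>)
  ultimately have "\<forall>\<^sub>F j in sequentially. d j < \<delta> \<and> C * exp (- c * L j) < e"
    by (rule eventually_conj)
  then obtain j where j: "d j < \<delta>" "C * exp (- c * L j) < e"
    using eventually_happens'[OF sequentially_bot] by blast
  obtain F where "finite F" "?F \<subseteq> \<Union>F" "\<forall>B\<in>F. bounded B \<and> diameter B \<le> d j"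
      "real (card F) * d j powr s \<le> C * exp (- c * L j)" using cover[of j] by blast
  then show "\<exists>F d. finite F \<and> ?F \<subseteq> \<Union>F \<and> d \<le> \<delta> \<and>
       (\<forall>B\<in>F. bounded B \<and> diameter B \<le> d) \<and> real (card F) * d powr s < e"
    using j by (intro exI[of _ F] exI[of _ "d j"]) auto
qed

text \<open>
  The difference of the two sides is piecewise affine in \<open>u\<close> with breakpoints \<open>1 + \<tau> $ j\<close>: if the
  slope at \<open>u\<close> is nonnegative, compare with the last breakpoint before \<open>u\<close>, otherwise with the first
  one after \<open>u\<close>.
\<close>

lemma linear_le_of_breakpoints:
  fixes \<tau> :: "real ^ 'n" and c s u :: real
  assumes "0 < s" "s \<le> CARD('n)"
    and brk: "\<And>j. s * (1 + \<tau> $ j) \<le> c + (\<Sum>i\<in>UNIV. max 0 (\<tau> $ j - \<tau> $ i))"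
  shows "s * u \<le> c + (\<Sum>i\<in>UNIV. max 0 (u - 1 - \<tau> $ i))"
proof -
  \<comment> \<open>\<open>card S\<close> is the slope of the right-hand side just before
    \<open>u\<close>, so the sign of \<open>card S - s\<close> decides the breakpoint. The bounds on
    \<open>s\<close> ensure that it exists in either case.\<close>
  define S where "S = {i. 1 + \<tau> $ i < u}"
  have sum_S: "(\<Sum>i\<in>UNIV. if i \<in> S then d else 0) = card S * d" for d :: real
    by (simp add: sum.If_cases)
  show ?thesis
  proof (cases "s \<le> card S")
    case True
    then have "S \<noteq> {}" using \<open>0 < s\<close> by auto
    then have "Max ((\<lambda>i. \<tau> $ i) ` S) \<in> (\<lambda>i. \<tau> $ i) ` S" by (intro Max_in) auto
    then obtain j where j: "j \<in> S" "\<tau> $ j = Max ((\<lambda>i. \<tau> $ i) ` S)" by auto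
    have j_max: "\<tau> $ i \<le> \<tau> $ j" if "i \<in> S" for i unfolding j(2) using that by (intro Max_ge) auto
    have "(\<Sum>i\<in>UNIV. max 0 (\<tau> $ j - \<tau> $ i) + (if i \<in> S then u - 1 - \<tau> $ j else 0)) \<le>
        (\<Sum>i\<in>UNIV. max 0 (u - 1 - \<tau> $ i))"
    proof (intro sum_mono)
      fix i
      show "max 0 (\<tau> $ j - \<tau> $ i) + (if i \<in> S then u - 1 - \<tau> $ j else 0) \<le> max 0 (u - 1 - \<tau> $ i)"
        using j_max[of i] j(1) by (auto simp: S_def max_def)
    qed
    then have "(\<Sum>i\<in>UNIV. max 0 (\<tau> $ j - \<tau> $ i)) + card S * (u - 1 - \<tau> $ j) \<le>
        (\<Sum>i\<in>UNIV. max 0 (u - 1 - \<tau> $ i))" by (simp only: sum.distrib sum_S)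
    moreover have "s * (u - 1 - \<tau> $ j) \<le> card S * (u - 1 - \<tau> $ j)"
      using True j(1) by (intro mult_right_mono) (auto simp: S_def)
    ultimately show ?thesis using brk[of j] by (simp add: algebra_simps)
  next
    case False
    have "- S \<noteq> {}"
    proof
      assume "- S = {}"
      then have "S = UNIV" by blast
      then show False using False assms(2) by simp
    qed
    then have "Min ((\<lambda>i. \<tau> $ i) ` (- S)) \<in> (\<lambda>i. \<tau> $ i) ` (- S)" by (intro Min_in) auto
    then obtain j where j: "j \<in> - S" "\<tau> $ j = Min ((\<lambda>i. \<tau> $ i) ` (- S))" by auto
    have j_min: "\<tau> $ j \<le> \<tau> $ i" if "i \<notin> S" for i unfolding j(2) using that by (intro Min_le) auto
    have "(\<Sum>i\<in>UNIV. max 0 (\<tau> $ j - \<tau> $ i)) \<le>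
        (\<Sum>i\<in>UNIV. max 0 (u - 1 - \<tau> $ i) + (if i \<in> S then 1 + \<tau> $ j - u else 0))"
    proof (intro sum_mono)
      fix i
      show "max 0 (\<tau> $ j - \<tau> $ i) \<le> max 0 (u - 1 - \<tau> $ i) + (if i \<in> S then 1 + \<tau> $ j - u else 0)"
        using j_min[of i] j(1) by (auto simp: S_def max_def)
    qed
    then have "(\<Sum>i\<in>UNIV. max 0 (\<tau> $ j - \<tau> $ i)) \<le>
        (\<Sum>i\<in>UNIV. max 0 (u - 1 - \<tau> $ i)) + card S * (1 + \<tau> $ j - u)" by (simp only: sum.distrib sum_S)
    moreover have "card S * (1 + \<tau> $ j - u) \<le> s * (1 + \<tau> $ j - u)"
      using False j(1) by (intro mult_right_mono) (auto simp: S_def)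
    ultimately show ?thesis using brk[of j] by (simp add: algebra_simps)
  qed
qed

text \<open>The slack \<open>s0 - s\<close> pays for replacing \<open>k\<close> by
  \<open>k - \<delta>\<close> and \<open>\<tau> $ i\<close> by \<open>\<tau> $ i + \<delta>\<close>.
  After that the asymptotic growth conditions hold exactly on a tail, and only a tail matters for
  the set.\<close>

lemma hausdorff_measure_approximable_nonzero:
  fixes q :: "nat \<Rightarrow> nat" and \<tau> :: "real ^ 'n" and k s s0 :: real
  assumes q: "\<And>j. 0 < q j" and \<tau>: "\<And>i. 0 < \<tau> $ i" "\<And>i. \<tau> $ i < k - 1"
    and lim: "(\<lambda>j. ln (real (q (Suc j))) / ln (real (q j))) \<longlonglongrightarrow> k"
    and s: "0 < s" "s < s0" "s0 \<le> CARD('n)"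
    and brk: "\<And>j. s0 * (1 + \<tau> $ j) \<le>
      CARD('n) - (\<Sum>i\<in>UNIV. \<tau> $ i) / (k - 1) + (\<Sum>i\<in>UNIV. max 0 (\<tau> $ j - \<tau> $ i))"
  shows "hausdorff_measure s {x :: real ^ 'n. (\<forall>i. 0 \<le> x $ i \<and> x $ i \<le> 1) \<and>
         (\<forall>\<^sub>F j in sequentially. \<forall>i.
            nearest_int_dist (real (q j) * x $ i) < real (q j) powr (- (\<tau> $ i)))} \<noteq> 0"
proof -
  define L where "L = (\<lambda>j. ln (real (q j)))"
  have L_nonneg: "0 \<le> L j" for j using q[of j] by (simp add: L_def)
  have exp_L: "exp (L j) = real (q j)" for j using q[of j] by (simp add: L_def)
  have "1 < k" using \<tau>[of undefined] by linarith
  have "(\<lambda>j. L (Suc j) / L j) \<longlonglongrightarrow> k" using lim by (simp add: L_def)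
  note growth = growth_limit[OF L_nonneg this \<open>1 < k\<close>]
  have "((\<lambda>\<delta>. (\<Sum>i\<in>UNIV. \<tau> $ i + \<delta>) / (k - \<delta> - 1)) \<longlongrightarrow> (\<Sum>i\<in>UNIV. \<tau> $ i + 0) / (k - 0 - 1)) (at_right 0)"
    using \<open>1 < k\<close> by (intro tendsto_intros) auto
  then have "\<forall>\<^sub>F \<delta> in at_right 0.
      (\<Sum>i\<in>UNIV. \<tau> $ i + \<delta>) / (k - \<delta> - 1) < (\<Sum>i\<in>UNIV. \<tau> $ i) / (k - 1) + (s0 - s)"
    using s(2) by (intro order_tendstoD(2)) auto
  moreover have "\<forall>\<^sub>F \<delta> in at_right 0. \<forall>i. \<tau> $ i < k - \<delta> - 1"
  proof (rule eventually_all_finite)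
    fix i
    have "((\<lambda>\<delta>. k - \<delta> - 1) \<longlongrightarrow> k - 0 - 1) (at_right 0)" by (intro tendsto_intros)
    then show "\<forall>\<^sub>F \<delta> in at_right 0. \<tau> $ i < k - \<delta> - 1" using \<tau>(2)[of i] by (intro order_tendstoD(1)) auto
  qed
  ultimately have "\<forall>\<^sub>F \<delta> in at_right 0. (\<Sum>i\<in>UNIV. \<tau> $ i + \<delta>) / (k - \<delta> - 1) < (\<Sum>i\<in>UNIV. \<tau> $ i) / (k - 1) + (s0 - s) \<and>
      (\<forall>i. \<tau> $ i < k - \<delta> - 1) \<and> (0::real) < \<delta>"
    by (intro eventually_conj eventually_at_right_less)
  then obtain \<delta> where \<delta>: "(\<Sum>i\<in>UNIV. \<tau> $ i + \<delta>) / (k - \<delta> - 1) < (\<Sum>i\<in>UNIV. \<tau> $ i) / (k - 1) + (s0 - s)"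
      "\<And>i. \<tau> $ i < k - \<delta> - 1" "0 < \<delta>"
    using eventually_happens'[OF trivial_limit_at_right_real] by blast
  define \<kappa> where "\<kappa> = k - \<delta>"
  have L_ev: "\<forall>\<^sub>F j in sequentially. c \<le> b * L j" if "0 < b" for b c
  proof -
    have "\<forall>\<^sub>F j in sequentially. c / b \<le> L j" using growth(3) unfolding filterlim_at_top by blast
    then show ?thesis by eventually_elim (use that in \<open>simp add: pos_divide_le_eq mult.commute\<close>)
  qed
  \<comment> \<open>The last two conditions together give the growth required of a
    \<open>cantor_tree\<close>: the surplus of \<open>\<kappa>\<close> over
    \<open>1 + \<tau> $ i\<close> eventually exceeds \<open>ln 4\<close>.\<close>
  have "\<forall>\<^sub>F j in sequentially. ln 2 \<le> 1 * L j \<and> ln 8 \<le> \<delta> * L j \<and> \<kappa> * L j \<le> L (Suc j) \<and>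
      (\<forall>i. ln 4 \<le> (\<kappa> - 1 - \<tau> $ i) * L j)"
    using \<delta> by (intro eventually_conj L_ev growth(1) eventually_all_finite) (auto simp: \<kappa>_def algebra_simps)
  then obtain J where J: "\<And>j. j \<ge> J \<Longrightarrow> ln 2 \<le> 1 * L j \<and> ln 8 \<le> \<delta> * L j \<and> \<kappa> * L j \<le> L (Suc j) \<and>
      (\<forall>i. ln 4 \<le> (\<kappa> - 1 - \<tau> $ i) * L j)"
    unfolding eventually_sequentially by blast
  define L' where "L' = (\<lambda>j. L (j + J))"
  have tree: "cantor_tree L' (\<tau> $ i)" for i
  proof
    fix j
    show "0 < \<tau> $ i" by (rule \<tau>)
    show "ln 2 \<le> L' j" using J[of "j + J"] by (simp add: L'_def)
    have "ln 4 \<le> (\<kappa> - 1 - \<tau> $ i) * L' j" "\<kappa> * L' j \<le> L' (Suc j)"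
      using J[of "j + J"] by (simp_all add: L'_def)
    then show "(1 + \<tau> $ i) * L' j + ln 4 \<le> L' (Suc j)" by (simp add: algebra_simps)
  qed
  interpret t: cantor_tree L' "\<tau> $ i" for i by (rule tree)
  show ?thesis
  proof (rule hausdorff_measure_nonzero_of_trees[where L = L' and \<tau> = \<tau> and \<epsilon> = \<delta> and \<kappa> = \<kappa>])
    show "cantor_tree L' (\<tau> $ i)" for i by (rule tree)
    show "ln 8 \<le> \<delta> * L' l" "\<kappa> * L' l \<le> L' (Suc l)" for l using J[of "l + J"] by (simp_all add: L'_def)
    show "0 \<le> \<delta>" using \<delta> by simp
    show "1 < \<kappa>" using \<delta>(2)[of undefined] \<tau>(1)[of undefined] by (simp add: \<kappa>_def)
    show "0 < s" by fact
  next
    fix u :: real assume "1 \<le> u"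
    have "s0 * u \<le> CARD('n) - (\<Sum>i\<in>UNIV. \<tau> $ i) / (k - 1) + (\<Sum>i\<in>UNIV. max 0 (u - 1 - \<tau> $ i))"
      using s by (intro linear_le_of_breakpoints brk) auto
    \<comment> \<open>Since \<open>u \<ge> 1\<close>, the slack does not shrink when multiplied by
      \<open>u\<close>.\<close>
    moreover have "(s0 - s) * 1 \<le> (s0 - s) * u" using s \<open>1 \<le> u\<close> by (intro mult_left_mono) auto
    ultimately show "s * u \<le> CARD('n) - (\<Sum>i\<in>UNIV. \<tau> $ i + \<delta>) / (\<kappa> - 1) + (\<Sum>i\<in>UNIV. max 0 (u - 1 - \<tau> $ i))"
      using \<delta>(1) unfolding \<kappa>_def left_diff_distrib by linarith
  next
    fix x :: "real ^ 'n" assume x: "\<And>i m. x $ i \<in> t.stage i m"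
    have "0 \<le> x $ i \<and> x $ i \<le> 1" for i using x[of i 0] t.stage_0[of i] by auto
    moreover have "\<forall>\<^sub>F j in sequentially. \<forall>i.
            nearest_int_dist (real (q j) * x $ i) < real (q j) powr (- (\<tau> $ i))"
      using eventually_ge_at_top[of J]
    proof (eventually_elim, intro allI)
      fix j i assume "J \<le> j"
      then have L': "L' (j - J) = L j" by (simp add: L'_def)
      obtain p where "\<bar>t.pt (j - J) p - x $ i\<bar> \<le> t.radius i (j - J)"
        using x[of i "j - J"] by (auto simp: t.stage_def dist_real_def)
      then have "\<bar>real_of_int p * exp (- L j) - x $ i\<bar> * exp (L j) \<le>
          exp (- (1 + \<tau> $ i) * L j) / 2 * exp (L j)"
        unfolding t.pt_def t.radius_def L' by (rule mult_right_mono) simp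
      also have "\<dots> = exp (- \<tau> $ i * L j) / 2" by (simp add: algebra_simps flip: exp_add)
      also have "\<dots> < exp (- \<tau> $ i * L j)" by simp
      also have "\<bar>real_of_int p * exp (- L j) - x $ i\<bar> * exp (L j) =
          \<bar>(real_of_int p * exp (- L j) - x $ i) * exp (L j)\<bar>" by (simp add: abs_mult)
      also have "(real_of_int p * exp (- L j) - x $ i) * exp (L j) = real_of_int p - q j * x $ i"
        using q[of j] by (simp add: exp_minus exp_L field_simps)
      also have "exp (- \<tau> $ i * L j) = real (q j) powr (- (\<tau> $ i))"
        using q[of j] by (simp add: powr_def L_def)
      finally have "dist (real (q j) * x $ i) (real_of_int p) < real (q j) powr (- (\<tau> $ i))"
        by (simp add: dist_real_def abs_minus_commute)
      moreover have "nearest_int_dist (real (q j) * x $ i) \<le> dist (real (q j) * x $ i) (real_of_int p)"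
        unfolding nearest_int_dist_def by (rule infdist_le) simp
      ultimately show "nearest_int_dist (real (q j) * x $ i) < real (q j) powr (- (\<tau> $ i))" by linarith
    qed
    ultimately show "x \<in> {x :: real ^ 'n. (\<forall>i. 0 \<le> x $ i \<and> x $ i \<le> 1) \<and>
         (\<forall>\<^sub>F j in sequentially. \<forall>i.
            nearest_int_dist (real (q j) * x $ i) < real (q j) powr (- (\<tau> $ i)))}" by blast
  qed
qed

text \<open>The strict inequality at \<open>a\<close> survives a small \<open>\<delta>\<close> in
  \<open>k + \<delta>\<close> and \<open>\<tau> $ i - \<delta>\<close>. The set is then split by the
  index from which its inequalities hold, and every piece is null.\<close>

lemma hausdorff_measure_approximable_eq_0:
  fixes q :: "nat \<Rightarrow> nat" and \<tau> :: "real ^ 'n" and k s :: real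
  assumes q: "\<And>j. 0 < q j" and \<tau>: "\<And>i. 0 < \<tau> $ i" "\<And>i. \<tau> $ i < k - 1"
    and lim: "(\<lambda>j. ln (real (q (Suc j))) / ln (real (q j))) \<longlonglongrightarrow> k"
    and "0 < s"
    and a: "CARD('n) - (\<Sum>i\<in>UNIV. \<tau> $ i) / (k - 1) + (\<Sum>i\<in>UNIV. max 0 (\<tau> $ a - \<tau> $ i)) < s * (1 + \<tau> $ a)"
  shows "hausdorff_measure s {x :: real ^ 'n. (\<forall>i. 0 \<le> x $ i \<and> x $ i \<le> 1) \<and>
         (\<forall>\<^sub>F j in sequentially. \<forall>i.
            nearest_int_dist (real (q j) * x $ i) < real (q j) powr (- (\<tau> $ i)))} = 0"
    (is "hausdorff_measure s ?A = 0")
proof -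
  define L where "L = (\<lambda>j. ln (real (q j)))"
  have L_nonneg: "0 \<le> L j" for j using q[of j] by (simp add: L_def)
  have exp_L: "exp (L j) = real (q j)" for j using q[of j] by (simp add: L_def)
  have "1 < k" using \<tau>[of undefined] by linarith
  have "(\<lambda>j. L (Suc j) / L j) \<longlonglongrightarrow> k" using lim by (simp add: L_def)
  note growth = growth_limit[OF L_nonneg this \<open>1 < k\<close>]
  define W where "W = (\<Sum>i\<in>UNIV. max 0 (\<tau> $ a - \<tau> $ i))"
  have "((\<lambda>\<delta>. CARD('n) - (\<Sum>i\<in>UNIV. \<tau> $ i - \<delta>) / (k + \<delta> - 1) + W) \<longlongrightarrow>
      CARD('n) - (\<Sum>i\<in>UNIV. \<tau> $ i - 0) / (k + 0 - 1) + W) (at_right 0)"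
    using \<open>1 < k\<close> by (intro tendsto_intros) auto
  then have "\<forall>\<^sub>F \<delta> in at_right 0.
      CARD('n) - (\<Sum>i\<in>UNIV. \<tau> $ i - \<delta>) / (k + \<delta> - 1) + W < s * (1 + \<tau> $ a)"
    using a by (intro order_tendstoD(2)) (auto simp: W_def)
  moreover have "\<forall>\<^sub>F \<delta> in at_right 0. \<forall>i. \<delta> < \<tau> $ i"
    by (intro eventually_all_finite order_tendstoD(2)[OF tendsto_ident_at] \<tau>)
  ultimately have "\<forall>\<^sub>F \<delta> in at_right 0.
      CARD('n) - (\<Sum>i\<in>UNIV. \<tau> $ i - \<delta>) / (k + \<delta> - 1) + W < s * (1 + \<tau> $ a) \<and>
      (\<forall>i. \<delta> < \<tau> $ i) \<and> (0::real) < \<delta>"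
    by (intro eventually_conj eventually_at_right_less)
  then obtain \<delta> where \<delta>: "CARD('n) - (\<Sum>i\<in>UNIV. \<tau> $ i - \<delta>) / (k + \<delta> - 1) + W < s * (1 + \<tau> $ a)"
      "\<And>i. \<delta> < \<tau> $ i" "0 < \<delta>"
    using eventually_happens'[OF trivial_limit_at_right_real] by blast
  define \<kappa> where "\<kappa> = k + \<delta>"
  have "\<forall>\<^sub>F j in sequentially. ln 5 / \<delta> \<le> L j" using growth(3) unfolding filterlim_at_top by blast
  then have "\<forall>\<^sub>F j in sequentially. ln 5 / \<delta> \<le> L j \<and> L (Suc j) \<le> \<kappa> * L j \<and>
      (\<forall>i. (1 + \<tau> $ i) * L j \<le> L (Suc j))"
    using \<delta>(3) \<tau>(2)
    by (intro eventually_conj growth(1,2) eventually_all_finite) (auto simp: \<kappa>_def algebra_simps)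
  then obtain J where J: "\<And>j. j \<ge> J \<Longrightarrow> ln 5 / \<delta> \<le> L j \<and> L (Suc j) \<le> \<kappa> * L j \<and>
      (\<forall>i. (1 + \<tau> $ i) * L j \<le> L (Suc j))"
    unfolding eventually_sequentially by blast
  \<comment> \<open>The offset \<open>m + J\<close> starts both after the inequalities for
    \<open>x\<close> hold and after the growth bounds do.\<close>
  define F where "F = (\<lambda>m. {x :: real ^ 'n. \<forall>i. 0 \<le> x $ i \<and> x $ i \<le> 1 \<and>
    (\<forall>j. infdist (exp (L (j + (m + J))) * x $ i) \<int> < exp (- \<tau> $ i * L (j + (m + J))))})"
  have "hausdorff_measure s (F m) = 0" for m
    unfolding F_def
  proof (rule hausdorff_measure_eq_0_of_growth[where \<epsilon> = \<delta> and \<kappa> = \<kappa> and a = a])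
    show "0 \<le> L (l + (m + J))" for l by (rule L_nonneg)
    show "filterlim (\<lambda>j. L (j + (m + J))) at_top sequentially"
      unfolding filterlim_sequentially_shift by (rule growth)
    show "(1 + \<tau> $ i) * L (l + (m + J)) \<le> L (Suc l + (m + J))" for i l
      using J[of "l + (m + J)"] by simp
    show "ln 5 \<le> \<delta> * L (l + (m + J))" for l
      using J[of "l + (m + J)"] \<delta>(3) by (simp add: pos_divide_le_eq mult.commute)
    show "\<delta> \<le> \<tau> $ i" "0 \<le> \<tau> $ i" for i using \<delta>(2)[of i] \<tau>(1)[of i] by simp_all
    show "1 < \<kappa>" using \<open>1 < k\<close> \<delta>(3) by (simp add: \<kappa>_def)
    show "L (Suc l + (m + J)) \<le> \<kappa> * L (l + (m + J))" for l using J[of "l + (m + J)"] by simp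
    show "0 < s" by fact
    show "CARD('n) - (\<Sum>i\<in>UNIV. \<tau> $ i - \<delta>) / (\<kappa> - 1) + (\<Sum>i\<in>UNIV. max 0 (\<tau> $ a - \<tau> $ i)) < s * (1 + \<tau> $ a)"
      using \<delta>(1) by (simp add: \<kappa>_def W_def)
  qed
  moreover have "?A \<subseteq> (\<Union>m. F m)"
  proof
    fix x assume x: "x \<in> ?A"
    then obtain m where m: "\<And>j i. m \<le> j \<Longrightarrow>
        nearest_int_dist (real (q j) * x $ i) < real (q j) powr (- (\<tau> $ i))"
      unfolding eventually_sequentially by blast
    have "infdist (exp (L (j + (m + J))) * x $ i) \<int> < exp (- \<tau> $ i * L (j + (m + J)))" for i j
      using m[of "j + (m + J)" i] q[of "j + (m + J)"]
      by (simp add: nearest_int_dist_def exp_L powr_def) (simp add: L_def)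
    then have "x \<in> F m" using x by (simp add: F_def)
    then show "x \<in> (\<Union>m. F m)" by blast
  qed
  ultimately show ?thesis by (rule hausdorff_measure_UN_eq_0)
qed

section \<open>The dimension formula\<close>

theorem theorem1p2:
  fixes q :: "nat \<Rightarrow> nat" and \<tau> :: "real ^ 'n" and k :: real
  assumes "\<And>j. 0 < q j"
    and "\<And>i. 0 < \<tau> $ i"
    and "(\<lambda>j. ln (real (q (Suc j))) / ln (real (q j))) \<longlonglongrightarrow> k"
    and "1 < k"
    and "(MAX i. \<tau> $ i) < k - 1"
  shows "hausdorff_dim
      {x :: real ^ 'n. (\<forall>i. 0 \<le> x $ i \<and> x $ i \<le> 1) \<and>
         (\<forall>\<^sub>F j in sequentially. \<forall>i.
            nearest_int_dist (real (q j) * x $ i) < real (q j) powr (- (\<tau> $ i)))} =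
    ereal (MIN j. (real CARD('n) - 1 / (k - 1) * (\<Sum>i\<in>UNIV. \<tau> $ i)
                     + (\<Sum>i\<in>{i. \<tau> $ j > \<tau> $ i}. \<tau> $ j - \<tau> $ i)) / (\<tau> $ j + 1))"
    (is "hausdorff_dim ?A = ereal (MIN j. ?f j)")
proof -
  define c where "c = CARD('n) - (\<Sum>i\<in>UNIV. \<tau> $ i) / (k - 1)"
  define M where "M = (\<lambda>j. \<Sum>i\<in>UNIV. max 0 (\<tau> $ j - \<tau> $ i))"
  define s0 where "s0 = (MIN j. ?f j)"
  have \<tau>k: "\<tau> $ i < k - 1" for i
  proof -
    have "\<tau> $ i \<le> (MAX i. \<tau> $ i)" by (intro Max_ge) auto
    then show ?thesis using assms(5) by linarith
  qed
  have f: "?f j = (c + M j) / (1 + \<tau> $ j)" for j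
  proof -
    have "M j = (\<Sum>i\<in>UNIV. if \<tau> $ j > \<tau> $ i then \<tau> $ j - \<tau> $ i else 0)"
      unfolding M_def by (intro sum.cong) auto
    also have "\<dots> = (\<Sum>i\<in>{i. \<tau> $ j > \<tau> $ i}. \<tau> $ j - \<tau> $ i)" by (simp add: sum.If_cases)
    finally show ?thesis by (simp add: c_def add.commute)
  qed
  have "s0 \<in> range ?f" unfolding s0_def by (intro Min_in) auto
  \<comment> \<open>The upper bound uses only the minimising index \<open>a\<close>; the lower bound
    uses the inequality for every index.\<close>
  then obtain a where a: "s0 = (c + M a) / (1 + \<tau> $ a)" unfolding f by blast
  have brk: "s0 * (1 + \<tau> $ j) \<le> c + M j" for j
  proof -
    have "s0 \<le> ?f j" unfolding s0_def by (intro Min_le) auto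
    then show ?thesis unfolding f using assms(2)[of j] by (simp add: pos_le_divide_eq)
  qed
  \<comment> \<open>Here the bound on the maximum of \<tau> enters: it makes \<open>c\<close>, and
    therefore \<open>s0\<close>, positive.\<close>
  have "(\<Sum>i\<in>UNIV. \<tau> $ i) < (\<Sum>i\<in>(UNIV :: 'n set). k - 1)" by (intro sum_strict_mono \<tau>k) auto
  then have "c > 0" using assms(4) by (simp add: c_def pos_divide_less_eq)
  have "M a \<ge> 0" unfolding M_def by (intro sum_nonneg) auto
  then have "s0 > 0" unfolding a using \<open>c > 0\<close> assms(2)[of a] by (intro divide_pos_pos) auto
  have "s0 \<le> CARD('n)"
  proof -
    \<comment> \<open>At the smallest \<tau> the sum of maxima vanishes, which gives
      \<open>s0 \<le> c\<close>. The resulting bound by the dimension is needed for the comparison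
      at breakpoints.\<close>
    have "Min (range (\<lambda>i. \<tau> $ i)) \<in> range (\<lambda>i. \<tau> $ i)" by (intro Min_in) auto
    then obtain b where b: "\<tau> $ b = Min (range (\<lambda>i. \<tau> $ i))" by (metis rangeE)
    have "\<tau> $ b \<le> \<tau> $ i" for i unfolding b by (intro Min_le) auto
    then have "M b = 0" by (simp add: M_def)
    have "s0 * 1 \<le> s0 * (1 + \<tau> $ b)"
      using \<open>s0 > 0\<close> assms(2)[of b] by (intro mult_left_mono) auto
    also have "\<dots> \<le> c" using brk[of b] \<open>M b = 0\<close> by simp
    also have "c \<le> CARD('n)"
      unfolding c_def using assms(4) sum_nonneg[of UNIV "\<lambda>i. \<tau> $ i"] less_imp_le[OF assms(2)] by simp
    finally show ?thesis by simp
  qed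
  have upper: "hausdorff_measure s ?A = 0" if "s0 < s" for s
  proof (rule hausdorff_measure_approximable_eq_0[where a = a, OF assms(1,2) \<tau>k assms(3)])
    show "0 < s" using that \<open>s0 > 0\<close> by linarith
    have "c + M a = s0 * (1 + \<tau> $ a)" using assms(2)[of a] by (simp add: a)
    also have "\<dots> < s * (1 + \<tau> $ a)" using that assms(2)[of a] by (intro mult_strict_right_mono) auto
    finally show "CARD('n) - (\<Sum>i\<in>UNIV. \<tau> $ i) / (k - 1) + (\<Sum>i\<in>UNIV. max 0 (\<tau> $ a - \<tau> $ i)) < s * (1 + \<tau> $ a)"
      by (simp add: c_def M_def)
  qed
  have lower: "hausdorff_measure s ?A \<noteq> 0" if "0 < s" "s < s0" for s
    using brk unfolding c_def M_def
    by (intro hausdorff_measure_approximable_nonzero[OF assms(1,2) \<tau>k assms(3) that \<open>s0 \<le> CARD('n)\<close>])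
  \<comment> \<open>Nonemptiness follows from the lower bound at \<open>s0 / 2\<close>, since the
    empty set is null there.\<close>
  have "?A \<noteq> {}"
  proof
    assume "?A = {}"
    moreover have "hausdorff_measure (s0 / 2) ({} :: (real ^ 'n) set) = 0"
      using \<open>s0 > 0\<close> by (intro hausdorff_measure_eq_0_finite_covers) (auto intro!: exI[of _ "{}"])
    ultimately have "hausdorff_measure (s0 / 2) ?A = 0" by (simp only:)
    then show False using lower[of "s0 / 2"] \<open>s0 > 0\<close> by linarith
  qed
  then have lower_0: "hausdorff_measure 0 ?A \<noteq> 0" by (rule hausdorff_measure_0_nonzero)
  have "hausdorff_dim ?A = ereal s0"
  proof (rule antisym)
    show "hausdorff_dim ?A \<le> ereal s0"
    proof (rule ereal_le_epsilon2)
      fix e :: real assume "0 < e"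
      then show "hausdorff_dim ?A \<le> ereal s0 + ereal e"
        unfolding hausdorff_dim_def using upper[of "s0 + e"] \<open>s0 > 0\<close>
        by (intro INF_lower2[of "s0 + e"]) auto
    qed
    show "ereal s0 \<le> hausdorff_dim ?A"
      unfolding hausdorff_dim_def
    proof (rule INF_greatest)
      fix s assume "s \<in> {s. 0 \<le> s \<and> hausdorff_measure s ?A = 0}"
      then have "0 \<le> s" "hausdorff_measure s ?A = 0" by auto
      then have "\<not> s < s0" using lower[of s] lower_0 by (cases "s = 0") auto
      then show "ereal s0 \<le> ereal s" by simp
    qed
  qed
  then show ?thesis by (simp only: s0_def)
qed

end
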